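(* Let $X_0,X_1,\dots,X_n$ be real vector fields on a bounded domain $\Omega\subset\mathbb{R}^p$ satisfying assumptions (C) for some integer $r\ge2$. 1. (Local connectivity) For any $x_0\in\Omega$ there exist two neighborhoods $U\subset V\subset\Omega$ of $x_0$ such that any two points of $U$ can be connected by a curve contained in $V$ which is composed of a finite number of arcs of integral curves of the vector fields $X_i$, $i=0,1,\dots,n$. 2. (Global connectivity) If $\Omega$ is connected, then for any two points $x,y\in\Omega$ there exists a curve joining $x$ to $y$ and contained in $\Omega$ which is composed of a finite number of arcs of integral curves of the vector fields $X_i$, $i=0,1,\dots,n$.
   Context: Weights: $p_0=2$ and $p_i=1$ for $i=1,\dots,n$. For a multiindex $I=(i_1,\dots,i_k)$ with entries in $\{0,1,\dots,n\}$, the weight is $|I|=\sum_{j=1}^k p_{i_j}$, and $X_{[I]}=[X_{i_1},[X_{i_2},\dots[X_{i_{k-1}},X_{i_k}]\dots]]$ (with $X_{[I]}=X_{i_1}$ if $I=(i_1)$), where $[X,Y]=XY-YX$. $(X_{[I]})_x$ denotes the vector field $X_{[I]}$ evaluated at $x$. Assumptions (C), for an integer $r\ge2$: the coefficients of $X_1,\dots,X_n$ belong to $C^{r-1}(\overline\Omega)$; the coefficients of $X_0$ belong to $C^{r-2}(\overline\Omega)$ and, in the case $r=2$, moreover to $C^1$; the vectors $\{(X_{[I]})_x\}_{|I|\le r}$ span $\mathbb{R}^p$ at every $x\in\Omega$. Arcs of integral curves may be traversed in either direction (i.e. each arc is of the form $\tau\mapsto\exp(\pm\tau X_i)(z)$,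 $\tau$ in a compact interval $[0,T]$, where $\exp(\tau X)(z)$ is the value at time $\tau$ of the solution of $\varphi'=X_\varphi$, $\varphi(0)=z$). *)

theory Defs
  imports "HOL-Analysis.Analysis"
begin

text \<open>
  A vector field $X = \sum_j b_j \partial_{x_j}$ is represented by its coefficient map
  $x \mapsto (b_1(x), \dots, b_p(x))$, as a total function of which only the values on the open set
  \<open>\<Omega>\<close> matter. Below, the differential operator $X$ is applied to functions,
  scalar or vector valued.
\<close>

definition lie_derivative ::
    "(real^'p \<Rightarrow> real^'p) \<Rightarrow> (real^'p \<Rightarrow> 'b::real_normed_vector) \<Rightarrow> real^'p \<Rightarrow> 'b" where
  "lie_derivative X f = (\<lambda>x. frechet_derivative f (at x) (X x))"

text \<open>
  The second order terms of $XY - YX$ cancel, so it is the vector field whose $j$-th coefficient is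
  its value on the coordinate function $x_j$, namely $X(Y_j) - Y(X_j)$.
\<close>

definition commutator ::
    "(real^'p \<Rightarrow> real^'p) \<Rightarrow> (real^'p \<Rightarrow> real^'p) \<Rightarrow> real^'p \<Rightarrow> real^'p" where
  "commutator X Y = (\<lambda>x. lie_derivative X Y x - lie_derivative Y X x)"

text \<open>Multiindices are nonempty lists; the value at the empty list is a dummy.\<close>

fun iterated_commutator ::
    "(nat \<Rightarrow> real^'p \<Rightarrow> real^'p) \<Rightarrow> nat list \<Rightarrow> real^'p \<Rightarrow> real^'p" where
  "iterated_commutator X [] = (\<lambda>x. 0)"
| "iterated_commutator X [i] = X i"
| "iterated_commutator X (i # j # I) = commutator (X i) (iterated_commutator X (j # I))"

definition multiindices :: "nat \<Rightarrow> nat list set" where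
  "multiindices n = {I. I \<noteq> [] \<and> set I \<subseteq> {0..n}}"

definition weight :: "nat list \<Rightarrow> nat" where
  "weight I = (\<Sum>i\<leftarrow>I. if i = 0 then 2 else 1)"

definition partial :: "'p \<Rightarrow> (real^'p \<Rightarrow> real) \<Rightarrow> real^'p \<Rightarrow> real" where
  "partial j f = (\<lambda>x. frechet_derivative f (at x) (axis j 1))"

definition iterated_partial :: "'p list \<Rightarrow> (real^'p \<Rightarrow> real) \<Rightarrow> real^'p \<Rightarrow> real" where
  "iterated_partial js f = foldr partial js f"

text \<open>$C^k(\Omega)$ for open \<open>\<Omega>\<close>.\<close>

definition C_on :: "nat \<Rightarrow> (real^'p) set \<Rightarrow> (real^'p \<Rightarrow> real) \<Rightarrow> bool" where
  "C_on k \<Omega> f \<longleftrightarrow>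
     (\<forall>js. length js < k \<longrightarrow> iterated_partial js f differentiable_on \<Omega>) \<and>
     (\<forall>js. length js \<le> k \<longrightarrow> continuous_on \<Omega> (iterated_partial js f))"

text \<open>
  $C^k(\overline\Omega)$ for open \<open>\<Omega>\<close>: all derivatives of order at most \<open>k\<close> extend
  continuously from \<open>\<Omega>\<close> to its closure.
\<close>

definition C_on_closure :: "nat \<Rightarrow> (real^'p) set \<Rightarrow> (real^'p \<Rightarrow> real) \<Rightarrow> bool" where
  "C_on_closure k \<Omega> f \<longleftrightarrow>
     C_on k \<Omega> f \<and>
     (\<forall>js. length js \<le> k \<longrightarrow>
        (\<exists>g. continuous_on (closure \<Omega>) g \<and> (\<forall>x\<in>\<Omega>. g x = iterated_partial js f x)))"

definition assumptions_C ::
    "nat \<Rightarrow> nat \<Rightarrow> (real^'p) set \<Rightarrow> (nat \<Rightarrow> real^'p \<Rightarrow> real^'p) \<Rightarrow> bool" where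
  "assumptions_C r n \<Omega> X \<longleftrightarrow>
     (\<forall>i\<in>{1..n}. \<forall>j. C_on_closure (r - 1) \<Omega> (\<lambda>x. X i x $ j)) \<and>
     (\<forall>j. C_on_closure (r - 2) \<Omega> (\<lambda>x. X 0 x $ j)) \<and>
     (r = 2 \<longrightarrow> (\<forall>j. C_on 1 \<Omega> (\<lambda>x. X 0 x $ j))) \<and>
     (\<forall>x\<in>\<Omega>. span {iterated_commutator X I x | I. I \<in> multiindices n \<and> weight I \<le> r} = UNIV)"

text \<open>
  \<open>\<phi>\<close> is $\tau \mapsto \exp(\tau X)(z)$ on $[0,T]$. Since $\exp(-\tau X) = \exp(\tau(-X))$, an arc
  traversed backwards is an integral curve of \<open>- X\<close>.
\<close>

definition integral_curve ::
    "(real^'p \<Rightarrow> real^'p) \<Rightarrow> real^'p \<Rightarrow> real \<Rightarrow> (real \<Rightarrow> real^'p) \<Rightarrow> bool" where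
  "integral_curve X z T \<phi> \<longleftrightarrow>
     0 \<le> T \<and> \<phi> 0 = z \<and>
     (\<forall>\<tau>\<in>{0..T}. (\<phi> has_vector_derivative X (\<phi> \<tau>)) (at \<tau> within {0..T}))"

definition integral_arc ::
    "nat \<Rightarrow> (nat \<Rightarrow> real^'p \<Rightarrow> real^'p) \<Rightarrow> real^'p \<Rightarrow> real \<Rightarrow> (real \<Rightarrow> real^'p) \<Rightarrow> bool" where
  "integral_arc n X z T \<phi> \<longleftrightarrow>
     (\<exists>i\<in>{0..n}. integral_curve (X i) z T \<phi> \<or> integral_curve (\<lambda>x. - X i x) z T \<phi>)"

text \<open>
  The curve \<open>\<gamma>\<close> on $[0,L]$ is split at \<open>0 = t 0 \<le> \<dots> \<le> t m = L\<close> into \<open>m\<close> consecutive arcs. The case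
  \<open>m = 0\<close> is the constant curve at a point, which is also an arc with \<open>T = 0\<close>.
\<close>

definition composed_of_integral_arcs ::
    "nat \<Rightarrow> (nat \<Rightarrow> real^'p \<Rightarrow> real^'p) \<Rightarrow> real \<Rightarrow> (real \<Rightarrow> real^'p) \<Rightarrow> bool" where
  "composed_of_integral_arcs n X L \<gamma> \<longleftrightarrow>
     (\<exists>(m::nat) t. t 0 = 0 \<and> t m = L \<and>
        (\<forall>k<m. integral_arc n X (\<gamma> (t k)) (t (Suc k) - t k) (\<lambda>\<tau>. \<gamma> (t k + \<tau>))))"

definition connected_by_integral_arcs ::
    "nat \<Rightarrow> (nat \<Rightarrow> real^'p \<Rightarrow> real^'p) \<Rightarrow> (real^'p) set \<Rightarrow> real^'p \<Rightarrow> real^'p \<Rightarrow> bool" where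
  "connected_by_integral_arcs n X V x y \<longleftrightarrow>
     (\<exists>L\<ge>0. \<exists>\<gamma>. continuous_on {0..L} \<gamma> \<and> \<gamma> ` {0..L} \<subseteq> V \<and> \<gamma> 0 = x \<and> \<gamma> L = y \<and>
        composed_of_integral_arcs n X L \<gamma>)"

end

theory Submission
  imports Defs
begin

text \<open>
  Chow's theorem for commutators of low regularity. A vector field $Z$ is steered to first order
  if for every small $d$ some jointly continuous $A(h, y)$, $|h| \le d$, moves $y$ along arcs to
  within $o(d)$ of $y + h Z(y)$. For a $C^1$ field this improves itself: running many tiny steps
  (an Euler polygon) gives $y + h Z + \frac{h^2}{2} DZ\, Z$ up to $o(d^2)$. With two $C^1$ fields
  steered to second order, the loop $X, Y, -X, -Y$ with times $\pm\sqrt{h}$ steers $[X, Y]$ to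
  first order, and only the continuity of $[X, Y]$ matters. So every $X_{[I]}$ with $|I| \le r$,
  which has regularity $C^{r - |I|}$, is steered to first order. Composing $p$ of them that span
  at $x$ gives a continuous map close to an invertible affine one, whose image covers a
  neighbourhood of $x$ by Brouwer's theorem. Hence the orbits of arcs inside any open set are open,
  and a connected open set is a single orbit; locally one takes $U = V$ to be a ball.
\<close>

section \<open>Regularity of commutators\<close>

text \<open>The obstacle is that a commutator of weight \<open>r\<close> is only continuous: it need
  not have a unique flow, and the endpoint maps of iterated loops need not be differentiable, so the
  inverse function theorem is out of reach. Brouwer's theorem asks only for a continuous map
  uniformly close to an affine one, and steering is designed to deliver just that.

  Intermediate commutators cannot be followed exactly either, since their integral curves are not
  arcs. In a loop with times of size \<open>sqrt h\<close>, an error \<open>o(sqrt h)\<close> per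
  side would swamp the commutator term, which has size \<open>h\<close>; each side has to be
  accurate to \<open>o(h)\<close>, and this is what the second order improvement provides. It costs
  one derivative of the field. That derivative is available where it is wanted: a commutator that
  enters a further bracket has weight below \<open>r\<close>, hence is \<open>C^1\<close>, and every
  \<open>X i\<close> is \<open>C^1\<close>, including \<open>X 0\<close>, which for
  \<open>r = 2\<close> is assumed separately.\<close>

lemma partial_cong:
  assumes "open V" "x \<in> V" "\<And>x. x \<in> V \<Longrightarrow> f x = g x"
  shows "partial j f x = partial j g x"
proof -
  have "(f has_derivative f') (at x) \<longleftrightarrow> (g has_derivative f') (at x)" for f'
    using assms by (metis has_derivative_transform_within_open)
  then show ?thesis by (simp add: partial_def frechet_derivative_def)
qed

lemma C_on_0: "C_on 0 V f \<longleftrightarrow> continuous_on V f"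
  by (simp add: C_on_def iterated_partial_def)

text \<open>\<open>foldr\<close> applies the last entry of the list first, so the recursion peels
  off the innermost derivative; this is why lists are split at their end.\<close>

lemma C_on_Suc:
  "C_on (Suc k) V f \<longleftrightarrow> f differentiable_on V \<and> (\<forall>j. C_on k V (partial j f))"
proof
  assume *: "C_on (Suc k) V f"
  then have "f differentiable_on V"
    unfolding C_on_def by (auto simp: iterated_partial_def dest: spec[where x="[]"])
  moreover have "C_on k V (partial j f)" for j
    unfolding C_on_def
  proof (intro conjI allI impI)
    fix js :: "'a list"
    have eq: "iterated_partial js (partial j f) = iterated_partial (js @ [j]) f"
      by (simp add: iterated_partial_def)
    show "iterated_partial js (partial j f) differentiable_on V" if "length js < k"
      using * that unfolding C_on_def eq by simp
    show "continuous_on V (iterated_partial js (partial j f))" if "length js \<le> k"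
      using * that unfolding C_on_def eq by simp
  qed
  ultimately show "f differentiable_on V \<and> (\<forall>j. C_on k V (partial j f))" by blast
next
  assume *: "f differentiable_on V \<and> (\<forall>j. C_on k V (partial j f))"
  show "C_on (Suc k) V f"
    unfolding C_on_def
  proof (intro conjI allI impI)
    fix js :: "'a list"
    show "iterated_partial js f differentiable_on V" if "length js < Suc k"
      using * that by (cases js rule: rev_cases) (auto simp: C_on_def iterated_partial_def)
    show "continuous_on V (iterated_partial js f)" if "length js \<le> Suc k"
      using * that
      by (cases js rule: rev_cases)
        (auto simp: C_on_def iterated_partial_def differentiable_imp_continuous_on)
  qed
qed

lemma C_on_mono: "C_on k V f \<Longrightarrow> l \<le> k \<Longrightarrow> C_on l V f"
  by (auto simp: C_on_def)

lemma C_on_subset: "C_on k V f \<Longrightarrow> W \<subseteq> V \<Longrightarrow> C_on k W f"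
  unfolding C_on_def by (blast intro: continuous_on_subset differentiable_on_subset)

lemma C_on_imp_differentiable:
  "open V \<Longrightarrow> C_on (Suc k) V f \<Longrightarrow> x \<in> V \<Longrightarrow> f differentiable (at x)"
  by (simp add: C_on_Suc differentiable_on_eq_differentiable_at)

lemma C_on_cong:
  assumes "open V" "\<And>x. x \<in> V \<Longrightarrow> f x = g x" "C_on k V f"
  shows "C_on k V g"
  using assms(2,3)
proof (induction k arbitrary: f g)
  case 0
  then show ?case by (metis C_on_0 continuous_on_cong)
next
  case (Suc k)
  have "g differentiable_on V"
    unfolding differentiable_on_eq_differentiable_at[OF assms(1)]
  proof
    fix x assume x: "x \<in> V"
    then obtain D where "(f has_derivative D) (at x)"
      using C_on_imp_differentiable[OF assms(1)] Suc.prems unfolding differentiable_def by blast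
    then have "(g has_derivative D) (at x)"
      by (rule has_derivative_transform_within_open[OF _ assms(1) x]) (rule Suc.prems)
    then show "g differentiable (at x)" by (auto simp: differentiable_def)
  qed
  moreover have "C_on k V (partial j g)" for j
    using Suc.IH[of "partial j f" "partial j g"] Suc.prems partial_cong[OF assms(1), of _ f g]
    by (simp add: C_on_Suc)
  ultimately show ?case by (simp add: C_on_Suc)
qed

lemma C_on_const: "open V \<Longrightarrow> C_on k V (\<lambda>x. c)"
proof (induction k arbitrary: c)
  case (Suc k)
  have "partial j (\<lambda>x. c) = (\<lambda>x. 0)" for j :: 'a
    by (simp add: partial_def fun_eq_iff frechet_derivative_const)
  then show ?case using Suc by (simp add: C_on_Suc)
qed (simp add: C_on_0)

lemma C_on_add:
  assumes "open V" "C_on k V f" "C_on k V g"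
  shows "C_on k V (\<lambda>x. f x + g x)"
  using assms(2,3)
proof (induction k arbitrary: f g)
  case 0
  then show ?case by (simp add: C_on_0 continuous_on_add)
next
  case (Suc k)
  have "C_on k V (partial j (\<lambda>x. f x + g x))" for j
  proof (rule C_on_cong[OF assms(1)])
    show "C_on k V (\<lambda>x. partial j f x + partial j g x)"
      using Suc by (simp add: C_on_Suc)
    fix x assume "x \<in> V"
    then have "f differentiable (at x)" "g differentiable (at x)"
      using C_on_imp_differentiable[OF assms(1)] Suc.prems by blast+
    then have "((\<lambda>x. f x + g x) has_derivative
        (\<lambda>v. frechet_derivative f (at x) v + frechet_derivative g (at x) v)) (at x)"
      by (intro has_derivative_add) (simp_all add: frechet_derivative_works[symmetric])
    from frechet_derivative_at[OF this, symmetric]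
    show "partial j f x + partial j g x = partial j (\<lambda>x. f x + g x) x"
      by (simp add: partial_def)
  qed
  then show ?case using Suc.prems by (simp add: C_on_Suc)
qed

lemma C_on_mult:
  assumes "open V" "C_on k V f" "C_on k V g"
  shows "C_on k V (\<lambda>x. f x * g x)"
  using assms(2,3)
proof (induction k arbitrary: f g)
  case 0
  then show ?case by (simp add: C_on_0 continuous_on_mult)
next
  case (Suc k)
  have "C_on k V (partial j (\<lambda>x. f x * g x))" for j
  proof (rule C_on_cong[OF assms(1)])
    have "C_on k V f" "C_on k V g" "C_on k V (partial j f)" "C_on k V (partial j g)"
      using Suc.prems C_on_mono[of "Suc k" V _ k] by (auto simp: C_on_Suc)
    then show "C_on k V (\<lambda>x. f x * partial j g x + partial j f x * g x)"
      by (intro C_on_add Suc.IH assms(1))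
    fix x assume "x \<in> V"
    then have "f differentiable (at x)" "g differentiable (at x)"
      using C_on_imp_differentiable[OF assms(1)] Suc.prems by blast+
    then have "((\<lambda>x. f x * g x) has_derivative
        (\<lambda>v. f x * frechet_derivative g (at x) v + frechet_derivative f (at x) v * g x)) (at x)"
      by (intro has_derivative_mult) (simp_all add: frechet_derivative_works[symmetric])
    from frechet_derivative_at[OF this, symmetric]
    show "f x * partial j g x + partial j f x * g x = partial j (\<lambda>x. f x * g x) x"
      by (simp add: partial_def)
  qed
  then show ?case using Suc.prems by (simp add: C_on_Suc)
qed

lemma C_on_sum:
  assumes "open V" "finite A" "\<And>i. i \<in> A \<Longrightarrow> C_on k V (f i)"
  shows "C_on k V (\<lambda>x. \<Sum>i\<in>A. f i x)"
  using assms(2,3) by (induction A) (auto intro!: C_on_add C_on_const assms(1))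

section \<open>Jacobians and the coordinate form of the bracket\<close>

lemma C_on_vec_imp_differentiable:
  fixes Z :: "real^'p \<Rightarrow> real^'p"
  assumes "open V" "\<And>j. C_on 1 V (\<lambda>x. Z x $ j)" "x \<in> V"
  shows "Z differentiable (at x)"
proof (subst differentiable_componentwise_within, intro ballI)
  fix b :: "real^'p" assume "b \<in> Basis"
  then obtain j where "b = axis j 1" by (auto simp: Basis_vec_def)
  then show "(\<lambda>y. Z y \<bullet> b) differentiable (at x)"
    using C_on_imp_differentiable[OF assms(1), of 0 "\<lambda>y. Z y $ j"] assms(2,3) by (simp add: inner_axis)
qed

lemma jacobian_nth:
  fixes Z :: "real^'p \<Rightarrow> real^'p"
  assumes "Z differentiable (at x)"
  shows "jacobian Z (at x) $ j $ i = partial i (\<lambda>y. Z y $ j) x"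
proof -
  have "((\<lambda>y. Z y $ j) has_derivative (\<lambda>v. frechet_derivative Z (at x) v $ j)) (at x)"
    using assms by (intro bounded_linear.has_derivative[OF bounded_linear_vec_nth])
      (simp add: frechet_derivative_works)
  from frechet_derivative_at[OF this, symmetric]
  show ?thesis by (simp add: jacobian_def matrix_def partial_def)
qed

lemma continuous_on_jacobian:
  fixes Z :: "real^'p \<Rightarrow> real^'p"
  assumes "open V" "\<And>j. C_on 1 V (\<lambda>x. Z x $ j)"
  shows "continuous_on V (\<lambda>x. jacobian Z (at x))"
proof -
  have "continuous_on V (\<lambda>x. \<chi> j i. partial i (\<lambda>y. Z y $ j) x)"
    using assms(2) by (intro continuous_on_vec_lambda) (auto simp: C_on_Suc C_on_0)
  then show ?thesis
    by (rule continuous_on_eq)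
      (simp add: vec_eq_iff jacobian_nth C_on_vec_imp_differentiable[OF assms])
qed

lemma commutator_eq_jacobian:
  assumes "open V" "\<And>j. C_on 1 V (\<lambda>x. X x $ j)" "\<And>j. C_on 1 V (\<lambda>x. Y x $ j)" "x \<in> V"
  shows "commutator X Y x = jacobian Y (at x) *v X x - jacobian X (at x) *v Y x"
proof -
  have "(X has_derivative (\<lambda>v. jacobian X (at x) *v v)) (at x)"
    "(Y has_derivative (\<lambda>v. jacobian Y (at x) *v v)) (at x)"
    using C_on_vec_imp_differentiable[OF assms(1,2,4)] C_on_vec_imp_differentiable[OF assms(1,3,4)]
    by (simp_all add: jacobian_works[symmetric])
  from this[THEN frechet_derivative_at, symmetric] show ?thesis
    by (simp add: commutator_def lie_derivative_def)
qed

lemma C_on_commutator: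
  assumes "open V" and X: "\<And>j. C_on (Suc k) V (\<lambda>x. X x $ j)"
    and Y: "\<And>j. C_on (Suc k) V (\<lambda>x. Y x $ j)"
  shows "C_on k V (\<lambda>x. commutator X Y x $ j)"
proof (rule C_on_cong[OF assms(1)])
  have 1: "C_on k V (\<lambda>x. X x $ j)" "C_on k V (\<lambda>x. Y x $ j)"
    "C_on k V (partial i (\<lambda>x. X x $ j))" "C_on k V (partial i (\<lambda>x. Y x $ j))" for i j
    using C_on_mono[OF X[of j], of k] C_on_mono[OF Y[of j], of k] X[of j] Y[of j]
    by (simp_all add: C_on_Suc)
  show "C_on k V (\<lambda>x. (\<Sum>i\<in>UNIV. partial i (\<lambda>x. Y x $ j) x * X x $ i)
      + (-1) * (\<Sum>i\<in>UNIV. partial i (\<lambda>x. X x $ j) x * Y x $ i))"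
    by (intro C_on_add C_on_mult C_on_sum C_on_const 1 assms(1)) auto
  fix x assume "x \<in> V"
  note x = this
  have X1: "C_on 1 V (\<lambda>x. X x $ j)" and Y1: "C_on 1 V (\<lambda>x. Y x $ j)" for j
    using C_on_mono[OF X, of 1] C_on_mono[OF Y, of 1] by simp_all
  note jac = jacobian_nth[OF C_on_vec_imp_differentiable[OF assms(1) X1 x]]
    jacobian_nth[OF C_on_vec_imp_differentiable[OF assms(1) Y1 x]]
  show "(\<Sum>i\<in>UNIV. partial i (\<lambda>x. Y x $ j) x * X x $ i)
      + (-1) * (\<Sum>i\<in>UNIV. partial i (\<lambda>x. X x $ j) x * Y x $ i) = commutator X Y x $ j"
    by (simp add: commutator_eq_jacobian[OF assms(1) X1 Y1 x] matrix_vector_mult_def jac)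
qed

lemma weight_Cons: "weight (i # I) = (if i = 0 then 2 else 1) + weight I"
  by (simp add: weight_def)

text \<open>A bracket loses one derivative, while prefixing \<open>i\<close> raises the weight by
  \<open>p_i \<ge> 1\<close>, so the count never falls behind. With \<open>s\<close> the target
  regularity, \<open>Suc s \<le> r - weight (k # J)\<close> because \<open>p_i \<ge> 1\<close>, and
  \<open>Suc s \<le> r - p_i\<close> because \<open>weight (k # J) \<ge> 1\<close>. The bound
  \<open>weight I \<le> r\<close> keeps the truncated subtraction meaningful.\<close>

lemma C_on_iterated_commutator:
  assumes "open V"
    and X: "\<And>i j. i \<in> {1..n} \<Longrightarrow> C_on (r - 1) V (\<lambda>x. X i x $ j)"
    and X0: "\<And>j. C_on (r - 2) V (\<lambda>x. X 0 x $ j)"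
    and "I \<in> multiindices n" "weight I \<le> r"
  shows "C_on (r - weight I) V (\<lambda>x. iterated_commutator X I x $ j)"
  using assms(4,5)
proof (induction I arbitrary: j rule: induct_list012)
  case 1
  then show ?case by (simp add: multiindices_def)
next
  case (2 i)
  then show ?case using X[of i] X0 by (auto simp: multiindices_def weight_def)
next
  case (3 i k J)
  define s where "s = r - weight (i # k # J)"
  have i: "i \<in> {0..n}" and kJ: "k # J \<in> multiindices n"
    using "3.prems" by (auto simp: multiindices_def)
  have w: "weight (k # J) \<ge> 1" "weight (k # J) + (if i = 0 then 2 else 1) \<le> r"
    using "3.prems" by (auto simp: weight_Cons)
  have 1: "C_on (Suc s) V (\<lambda>x. iterated_commutator X (k # J) x $ j)" for j
    using "3.IH"(2)[OF kJ] w C_on_mono[of "r - weight (k # J)" V _ "Suc s"]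
    by (auto simp: s_def weight_Cons split: if_splits)
  have 2: "C_on (Suc s) V (\<lambda>x. X i x $ j)" for j
  proof (cases "i = 0")
    case True
    then have "Suc s \<le> r - 2" using w by (simp add: s_def weight_Cons)
    then show ?thesis using X0 True C_on_mono by blast
  next
    case False
    then have "Suc s \<le> r - 1" using w by (simp add: s_def weight_Cons)
    then show ?thesis using i False by (intro C_on_mono[OF X]) auto
  qed
  show ?case using C_on_commutator[OF assms(1) 2 1] by (simp add: s_def)
qed

section \<open>Arcs and flows\<close>

text \<open>Reachability is the reflexive transitive closure of this relation. Working with
  endpoints makes composition trivial; a single parametrised curve is assembled only at the very
  end.\<close>

definition arc_step ::
    "nat \<Rightarrow> (nat \<Rightarrow> real^'p \<Rightarrow> real^'p) \<Rightarrow> (real^'p) set \<Rightarrow> real^'p \<Rightarrow> real^'p \<Rightarrow> bool" where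
  "arc_step n X V y z \<longleftrightarrow> (\<exists>T \<phi>. integral_arc n X y T \<phi> \<and> \<phi> ` {0..T} \<subseteq> V \<and> \<phi> T = z)"

section \<open>Reversal and concatenation of arcs\<close>

lemma integral_curve_cong:
  assumes "integral_curve X z T \<phi>" "\<And>\<tau>. \<tau> \<in> {0..T} \<Longrightarrow> \<psi> \<tau> = \<phi> \<tau>"
  shows "integral_curve X z T \<psi>"
  unfolding integral_curve_def
proof (intro conjI ballI)
  show "0 \<le> T" "\<psi> 0 = z" using assms by (auto simp: integral_curve_def)
  fix \<tau> assume \<tau>: "\<tau> \<in> {0..T}"
  then have "(\<phi> has_vector_derivative X (\<phi> \<tau>)) (at \<tau> within {0..T})"
    using assms(1) by (auto simp: integral_curve_def)
  then show "(\<psi> has_vector_derivative X (\<psi> \<tau>)) (at \<tau> within {0..T})"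
    using has_vector_derivative_transform[OF \<tau>, of \<psi> \<phi>] assms(2) \<tau> by auto
qed

lemma integral_arc_cong:
  assumes "integral_arc n X z T \<phi>" "\<And>\<tau>. \<tau> \<in> {0..T} \<Longrightarrow> \<psi> \<tau> = \<phi> \<tau>"
  shows "integral_arc n X z T \<psi>"
  using assms integral_curve_cong unfolding integral_arc_def by metis

lemma integral_curve_reverse:
  assumes "integral_curve X z T \<phi>"
  shows "integral_curve (\<lambda>x. - X x) (\<phi> T) T (\<lambda>\<tau>. \<phi> (T - \<tau>))"
  unfolding integral_curve_def
proof (intro conjI ballI)
  show "0 \<le> T" "\<phi> (T - 0) = \<phi> T" using assms by (auto simp: integral_curve_def)
  fix \<tau> assume \<tau>: "\<tau> \<in> {0..T}"
  have img: "(\<lambda>\<tau>. T - \<tau>) ` {0..T} = {0..T}"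
    by (simp add: image_diff_atLeastAtMost)
  have "((\<lambda>\<tau>. T - \<tau>) has_vector_derivative - 1) (at \<tau> within {0..T})"
    by (auto intro!: derivative_eq_intros)
  moreover have "(\<phi> has_vector_derivative X (\<phi> (T - \<tau>))) (at (T - \<tau>) within {0..T})"
    using assms \<tau> by (auto simp: integral_curve_def)
  ultimately show "((\<lambda>\<tau>. \<phi> (T - \<tau>)) has_vector_derivative - X (\<phi> (T - \<tau>))) (at \<tau> within {0..T})"
    using vector_diff_chain_within[of "\<lambda>\<tau>. T - \<tau>" "- 1" \<tau> "{0..T}" \<phi> "X (\<phi> (T - \<tau>))"]
    by (simp add: img o_def)
qed

lemma symp_arc_step: "symp (arc_step n X V)"
proof (rule sympI)
  fix y z assume "arc_step n X V y z"
  then obtain T \<phi> where \<phi>: "integral_arc n X y T \<phi>" "\<phi> ` {0..T} \<subseteq> V" "\<phi> T = z"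
    by (auto simp: arc_step_def)
  have "integral_arc n X z T (\<lambda>\<tau>. \<phi> (T - \<tau>))"
    using \<phi>(1) integral_curve_reverse[of "X _" y T \<phi>] integral_curve_reverse[of "\<lambda>x. - X _ x" y T \<phi>]
    unfolding integral_arc_def \<phi>(3)[symmetric] by auto
  moreover have "(\<lambda>\<tau>. \<phi> (T - \<tau>)) ` {0..T} \<subseteq> V" "\<phi> (T - T) = y"
    using \<phi> by (auto simp: integral_arc_def integral_curve_def image_subset_iff)
  ultimately show "arc_step n X V z y"
    unfolding arc_step_def by blast
qed

lemma arc_step_imp_in_domain: "arc_step n X V y z \<Longrightarrow> z \<in> V"
  by (force simp: arc_step_def integral_arc_def integral_curve_def)

lemma connected_by_integral_arcs_append:
  assumes "connected_by_integral_arcs n X V x y" "arc_step n X V y z"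
  shows "connected_by_integral_arcs n X V x z"
proof -
  obtain L \<gamma> m t where "L \<ge> 0" and \<gamma>: "continuous_on {0..L} \<gamma>" "\<gamma> ` {0..L} \<subseteq> V" "\<gamma> 0 = x" "\<gamma> L = y"
    and t: "t 0 = 0" "t m = L"
    and arcs: "\<And>k. k < m \<Longrightarrow> integral_arc n X (\<gamma> (t k)) (t (Suc k) - t k) (\<lambda>\<tau>. \<gamma> (t k + \<tau>))"
    using assms(1) unfolding connected_by_integral_arcs_def composed_of_integral_arcs_def by blast
  obtain T \<phi> where arc: "integral_arc n X y T \<phi>" and \<phi>: "\<phi> ` {0..T} \<subseteq> V" "\<phi> T = z"
    using assms(2) by (auto simp: arc_step_def)
  then have "T \<ge> 0" and \<phi>0: "\<phi> 0 = y" and cont: "continuous_on {0..T} \<phi>"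
    by (auto simp: integral_arc_def integral_curve_def continuous_on_eq_continuous_within
        intro: has_vector_derivative_continuous)
  define \<gamma>' where "\<gamma>' s = (if s \<le> L then \<gamma> s else \<phi> (s - L))" for s
  define t' where "t' k = (if k \<le> m then t k else L + T)" for k
  \<comment> \<open>Monotonicity of the breakpoints comes from the condition
    \<open>0 \<le> T\<close> of each arc, by downward induction from \<open>t m = L\<close>. It
    ensures that the old arcs see only the first branch of \<open>\<gamma>'\<close>.\<close>
  have tL: "t k \<le> L" if "k \<le> m" for k
    using that
  proof (induction rule: inc_induct)
    case (step k)
    then show ?case using arcs[of k] by (auto simp: integral_arc_def integral_curve_def)
  qed (simp add: t)
  have \<gamma>'L: "\<gamma>' (L + s) = \<phi> s" if "0 \<le> s" for s
    using that \<gamma>(4) \<phi>0 by (cases "s = 0") (auto simp: \<gamma>'_def)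
  have "integral_arc n X (\<gamma>' (t' k)) (t' (Suc k) - t' k) (\<lambda>\<tau>. \<gamma>' (t' k + \<tau>))" if "k < Suc m" for k
  proof (cases "k = m")
    case True
    then show ?thesis
      using integral_arc_cong[OF arc, of "\<lambda>\<tau>. \<gamma>' (L + \<tau>)"] \<gamma>'L[of 0] \<gamma>'L \<phi>0 by (simp add: t'_def t)
  next
    case False
    then have k: "k < m" using that by simp
    then have "\<gamma>' (t k + \<tau>) = \<gamma> (t k + \<tau>)" if "\<tau> \<in> {0..t (Suc k) - t k}" for \<tau>
      using that tL[of "Suc k"] by (auto simp: \<gamma>'_def)
    from integral_arc_cong[OF arcs[OF k] this] show ?thesis
      using k tL[of k] by (simp add: t'_def \<gamma>'_def)
  qed
  then have comp: "composed_of_integral_arcs n X (L + T) \<gamma>'"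
    unfolding composed_of_integral_arcs_def
    by (intro exI[of _ "Suc m"] exI[of _ t']) (simp add: t'_def t(1))
  have "continuous_on {0..L+T} \<gamma>'"
    unfolding \<gamma>'_def
  proof (rule continuous_on_cases_le)
    show "continuous_on {s \<in> {0..L+T}. s \<le> L} \<gamma>"
      by (rule continuous_on_subset[OF \<gamma>(1)]) auto
    show "continuous_on {s \<in> {0..L+T}. L \<le> s} (\<lambda>s. \<phi> (s - L))"
      by (rule continuous_on_compose2[OF cont]) (auto intro!: continuous_intros)
  qed (use \<gamma>(4) \<phi>0 in \<open>auto intro!: continuous_intros\<close>)
  moreover have "\<gamma>' ` {0..L+T} \<subseteq> V"
    using \<gamma>(2) \<phi>(1) by (auto simp: \<gamma>'_def image_subset_iff)
  moreover have "\<gamma>' 0 = x" "\<gamma>' (L + T) = z"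
    using \<gamma>'L[OF \<open>0 \<le> T\<close>] \<gamma> \<phi> \<open>0 \<le> L\<close> by (auto simp: \<gamma>'_def)
  ultimately show ?thesis
    unfolding connected_by_integral_arcs_def using comp \<open>0 \<le> T\<close> \<open>0 \<le> L\<close>
    by (intro exI[of _ "L + T"] conjI exI[of _ \<gamma>']) auto
qed

lemma connected_by_integral_arcs_if_rtranclp:
  assumes "(arc_step n X V)\<^sup>*\<^sup>* x y" "x \<in> V"
  shows "connected_by_integral_arcs n X V x y"
  using assms(1)
proof (induction rule: rtranclp_induct)
  case base
  show ?case
    unfolding connected_by_integral_arcs_def composed_of_integral_arcs_def using assms(2)
    by (intro exI[of _ 0] conjI exI[of _ "\<lambda>_. x"] exI[of _ "\<lambda>_. 0"]) auto
qed (rule connected_by_integral_arcs_append)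

text \<open>On the left the domain of integration is fixed, so continuity in \<open>t\<close>
  reduces to continuity of a parameter integral. The proof by the chain rule covers
  \<open>t = 0\<close>, where the substitution is not injective.\<close>

lemma integral_rescale:
  fixes g :: "real \<Rightarrow> 'a::euclidean_space"
  assumes "continuous_on {0..t} g" "0 \<le> t"
  shows "integral {0..1} (\<lambda>s. t *\<^sub>R g (t * s)) = integral {0..t} g"
proof -
  define G where "G \<sigma> = integral {0..\<sigma>} g" for \<sigma>
  have "((\<lambda>s. G (t * s)) has_vector_derivative t *\<^sub>R g (t * s)) (at s within {0..1})"
    if s: "s \<in> {0..1}" for s
  proof -
    have *: "t * s \<in> {0..t}" if "s \<in> {0..1}" for s
      using that assms(2) by (auto intro: mult_left_le)
    have "(G has_vector_derivative g (t * s)) (at (t * s) within {0..t})"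
      unfolding G_def by (rule integral_has_vector_derivative[OF assms(1) *[OF s]])
    then have "(G has_vector_derivative g (t * s)) (at (t * s) within (*) t ` {0..1})"
      by (rule has_vector_derivative_within_subset) (use * in auto)
    moreover have "((*) t has_vector_derivative t) (at s within {0..1})"
      by (auto intro!: derivative_eq_intros)
    ultimately show ?thesis
      using vector_diff_chain_within[of "(*) t"] by (fastforce simp: o_def)
  qed
  from fundamental_theorem_of_calculus[OF zero_le_one this]
  have "((\<lambda>s. t *\<^sub>R g (t * s)) has_integral (G (t * 1) - G (t * 0))) {0..1}" by simp
  then have "((\<lambda>s. t *\<^sub>R g (t * s)) has_integral integral {0..t} g) {0..1}"
    by (simp add: G_def)
  then show ?thesis by (rule integral_unique)
qed

text \<open>The fixed point is sought among bounded continuous functions of time and initial point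
  jointly, so that continuous dependence on the initial point comes for free.\<close>

lemma lipschitz_flow:
  fixes F :: "'a::euclidean_space \<Rightarrow> 'a"
  assumes lip: "\<And>x y. norm (F x - F y) \<le> L * norm (x - y)" and bd: "\<And>x. norm (F x) \<le> M"
  obtains T \<phi> where "T > 0" "continuous_on UNIV (\<lambda>(t, y). \<phi> t y)" "\<And>y. \<phi> 0 y = y"
    "\<And>t y. t \<in> {0..T} \<Longrightarrow> ((\<lambda>t. \<phi> t y) has_vector_derivative F (\<phi> t y)) (at t within {0..T})"
proof -
  \<comment> \<open>Chosen so that \<open>T * \<bar>L\<bar> \<le> 1/2\<close>, which is the
    contraction factor.\<close>
  define T where "T = 1 / (2 * (\<bar>L\<bar> + 1))"
  have "T > 0" by (simp add: T_def add_nonneg_pos)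
  \<comment> \<open>Clamping the time to \<open>{0..T}\<close> lets the unknown be a bounded
    function on the whole space of times and initial points.\<close>
  define \<tau> where "\<tau> t = max 0 (min T t)" for t
  have \<tau>: "0 \<le> \<tau> t" "\<tau> t \<le> T" for t using \<open>T > 0\<close> by (auto simp: \<tau>_def)
  have "M \<ge> 0" using bd[of 0] norm_ge_zero order_trans by blast
  have contF: "continuous_on UNIV F"
  proof (rule lipschitz_on_continuous_on, rule lipschitz_onI)
    show "dist (F x) (F y) \<le> \<bar>L\<bar> * dist x y" for x y
      using lip[of x y] mult_right_mono[OF abs_ge_self[of L] norm_ge_zero[of "x - y"]]
      unfolding dist_norm by linarith
  qed simp
  \<comment> \<open>The unknown is the displacement \<open>u (t, y) = \<phi> t y - y\<close>: it is
    bounded by \<open>T * M\<close>, whereas the flow itself is unbounded in \<open>y\<close>. Here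
    \<open>p = (t, y)\<close>, and the integral of \<open>f u p\<close> over \<open>{0..1}\<close>
    is the rescaled integral of \<open>F\<close> along the curve.\<close>
  define f where "f u p s = \<tau> (fst p) *\<^sub>R F (snd p + apply_bcontfun u (\<tau> (fst p) * s, snd p))"
    for u :: "(real \<times> 'a) \<Rightarrow>\<^sub>C 'a" and p s
  define P where "P u = Bcontfun (\<lambda>p. integral {0..1} (f u p))" for u
  have contf: "continuous_on UNIV (\<lambda>(p, s). f u p s)" for u
    unfolding f_def \<tau>_def split_beta
    by (intro continuous_intros continuous_on_compose2[OF contF]
        continuous_on_compose2[OF continuous_on_apply_bcontfun[of UNIV u]]) auto
  have contfs: "continuous_on {0..1} (f u p)" for u p
  proof -
    have "continuous_on {0..1} (\<lambda>s. (p, s))" by (intro continuous_intros)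
    from continuous_on_compose2[OF contf[of u] this] show ?thesis by simp
  qed
  have P: "apply_bcontfun (P u) p = integral {0..1} (f u p)" for u p
  proof -
    have "continuous_on UNIV (\<lambda>p. integral {0..1} (f u p))"
      using integral_continuous_on_param[of UNIV "0::real" 1 "f u"] continuous_on_subset[OF contf]
      by auto
    moreover have "norm (integral {0..1} (f u p)) \<le> T * M * (1 - 0)" for p
    proof (rule integral_bound[OF zero_le_one contfs])
      show "norm (f u p s) \<le> T * M" for s
        using \<tau>[of "fst p"] bd \<open>M \<ge> 0\<close> unfolding f_def norm_scaleR
        by (intro mult_mono) auto
    qed
    ultimately have "(\<lambda>p. integral {0..1} (f u p)) \<in> bcontfun"
      unfolding bcontfun_def bounded_iff by blast
    then show ?thesis by (simp add: P_def Bcontfun_inverse)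
  qed
  have "dist (P u) (P v) \<le> 1/2 * dist u v" for u v
  proof (rule dist_bound)
    fix p
    have "norm (integral {0..1} (\<lambda>s. f u p s - f v p s)) \<le> 1/2 * dist u v * (1 - 0)"
    proof (rule integral_bound[OF zero_le_one], intro continuous_intros contfs)
      fix s
      have "norm (f u p s - f v p s) \<le> T * (\<bar>L\<bar> * dist u v)"
        unfolding f_def scaleR_diff_right[symmetric] norm_scaleR
      proof (rule mult_mono)
        let ?q = "(\<tau> (fst p) * s, snd p)"
        have "norm (F (snd p + u ?q) - F (snd p + v ?q)) \<le> L * norm (u ?q - v ?q)"
          using lip[of "snd p + u ?q" "snd p + v ?q"] by simp
        also have "\<dots> \<le> \<bar>L\<bar> * dist u v"
          using dist_bounded[of u ?q v] by (intro mult_mono) (auto simp: dist_norm)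
        finally show "norm (F (snd p + u ?q) - F (snd p + v ?q)) \<le> \<bar>L\<bar> * dist u v" .
      qed (use \<tau>[of "fst p"] \<open>T > 0\<close> in auto)
      also have "\<dots> = (T * \<bar>L\<bar>) * dist u v" by simp
      also have "\<dots> \<le> 1/2 * dist u v"
        by (intro mult_right_mono) (auto simp: T_def field_simps)
      finally show "norm (f u p s - f v p s) \<le> 1/2 * dist u v" .
    qed
    then show "dist (P u p) (P v p) \<le> 1/2 * dist u v"
      by (simp add: P dist_norm integral_diff integrable_continuous_real contfs)
  qed
  then have "\<exists>!u\<in>UNIV. P u = u"
    by (intro Banach_fix[of _ "1/2"] complete_UNIV) auto
  then obtain u where u: "P u = u" by blast
  define \<phi> where "\<phi> t y = y + apply_bcontfun u (t, y)" for t y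
  have cont: "continuous_on UNIV (\<lambda>(t, y). \<phi> t y)"
    unfolding \<phi>_def split_beta by (auto intro!: continuous_intros)
  have cont1: "continuous_on A (\<lambda>\<sigma>. F (\<phi> \<sigma> y))" for y A
    unfolding \<phi>_def by (intro continuous_intros continuous_on_compose2[OF contF]
        continuous_on_compose2[OF continuous_on_apply_bcontfun[of UNIV u]]) auto
  have \<phi>: "\<phi> t y = y + integral {0..t} (\<lambda>\<sigma>. F (\<phi> \<sigma> y))" if "t \<in> {0..T}" for t y
  proof -
    have "\<tau> t = t" using that by (auto simp: \<tau>_def)
    then have "f u (t, y) = (\<lambda>s. t *\<^sub>R F (\<phi> (t * s) y))"
      by (simp add: fun_eq_iff f_def \<phi>_def)
    then have "apply_bcontfun u (t, y) = integral {0..1} (\<lambda>s. t *\<^sub>R F (\<phi> (t * s) y))"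
      using P[of u "(t, y)"] by (simp only: u)
    also have "\<dots> = integral {0..t} (\<lambda>\<sigma>. F (\<phi> \<sigma> y))"
      using integral_rescale[OF cont1] that by auto
    finally show ?thesis by (simp add: \<phi>_def)
  qed
  show ?thesis
  proof (rule that[OF \<open>T > 0\<close> cont])
    show "\<phi> 0 y = y" for y using \<phi>[of 0 y] \<open>T > 0\<close> by simp
    fix t y assume t: "t \<in> {0..T}"
    have "((\<lambda>t. y + integral {0..t} (\<lambda>\<sigma>. F (\<phi> \<sigma> y))) has_vector_derivative F (\<phi> t y)) (at t within {0..T})"
      using integral_has_vector_derivative[OF cont1 t, of y] by (auto intro!: derivative_eq_intros)
    then show "((\<lambda>t. \<phi> t y) has_vector_derivative F (\<phi> t y)) (at t within {0..T})"
      by (rule has_vector_derivative_transform[OF t, rotated]) (rule \<phi>)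
  qed
qed

section \<open>Steering along vector fields\<close>

text \<open>Precisely what the second order estimates consume: bounds, a Taylor remainder uniform in
  the base point, and uniform continuity of \<open>D y (Z y)\<close>, the acceleration along the
  flow. The derivative \<open>D\<close> is a parameter, so that the estimates can be made without
  matrices.\<close>

definition uniformly_C1 ::
    "'a set \<Rightarrow> ('a::euclidean_space \<Rightarrow> 'a) \<Rightarrow> ('a \<Rightarrow> 'a \<Rightarrow> 'a) \<Rightarrow> bool" where
  "uniformly_C1 B Z D \<longleftrightarrow>
     (\<exists>M. (\<forall>y\<in>B. norm (Z y) \<le> M \<and> linear (D y) \<and> (\<forall>v. norm (D y v) \<le> M * norm v) \<and>
            (\<forall>z\<in>B. norm (Z z - Z y) \<le> M * norm (z - y)))) \<and>
     (\<forall>e>0. \<exists>d>0. \<forall>y\<in>B. \<forall>z\<in>B. norm (z - y) \<le> d \<longrightarrow>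
        norm (Z z - Z y - D y (z - y)) \<le> e * norm (z - y) \<and> norm (D z (Z z) - D y (Z y)) \<le> e)"

lemma uniformly_C1_bounds:
  assumes "uniformly_C1 B Z D"
  obtains M where "M \<ge> 1" "\<And>y. y \<in> B \<Longrightarrow> norm (Z y) \<le> M" "\<And>y. y \<in> B \<Longrightarrow> linear (D y)"
    "\<And>y v. y \<in> B \<Longrightarrow> norm (D y v) \<le> M * norm v"
    "\<And>y z. y \<in> B \<Longrightarrow> z \<in> B \<Longrightarrow> norm (Z z - Z y) \<le> M * norm (z - y)"
proof -
  obtain M where M: "\<And>y. y \<in> B \<Longrightarrow> norm (Z y) \<le> M" "\<And>y. y \<in> B \<Longrightarrow> linear (D y)"
    "\<And>y v. y \<in> B \<Longrightarrow> norm (D y v) \<le> M * norm v"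
    "\<And>y z. y \<in> B \<Longrightarrow> z \<in> B \<Longrightarrow> norm (Z z - Z y) \<le> M * norm (z - y)"
    using assms unfolding uniformly_C1_def by metis
  show ?thesis
  proof (rule that[of "max M 1"])
    fix y z v
    have "M * norm w \<le> max M 1 * norm w" for w :: 'a by (intro mult_right_mono) auto
    then show "y \<in> B \<Longrightarrow> norm (D y v) \<le> max M 1 * norm v"
      "y \<in> B \<Longrightarrow> z \<in> B \<Longrightarrow> norm (Z z - Z y) \<le> max M 1 * norm (z - y)"
      using M(3,4) order_trans by blast+
  qed (use M(1,2) in \<open>auto simp: le_max_iff_disj\<close>)
qed

lemma uniformly_C1_modulus:
  assumes "uniformly_C1 B Z D" "e > 0"
  obtains d where "d > 0"
    "\<And>y z. y \<in> B \<Longrightarrow> z \<in> B \<Longrightarrow> norm (z - y) \<le> d \<Longrightarrow> norm (Z z - Z y - D y (z - y)) \<le> e * norm (z - y)"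
    "\<And>y z. y \<in> B \<Longrightarrow> z \<in> B \<Longrightarrow> norm (z - y) \<le> d \<Longrightarrow> norm (D z (Z z) - D y (Z y)) \<le> e"
  using assms unfolding uniformly_C1_def by metis

text \<open>\<open>\<Phi> h y\<close> is the ideal endpoint, \<open>A h y\<close> one that is really
  reached. The relation \<open>S\<close> stands for reachability and is kept abstract. Joint
  continuity is preserved by composition and finally feeds Brouwer's theorem;
  \<open>A 0 y = y\<close> allows maps for positive and negative parameters to be glued.\<close>

definition steering ::
    "('a \<Rightarrow> 'a \<Rightarrow> bool) \<Rightarrow> 'a set \<Rightarrow> real \<Rightarrow> real \<Rightarrow> (real \<Rightarrow> 'a::euclidean_space \<Rightarrow> 'a) \<Rightarrow>
      (real \<Rightarrow> 'a \<Rightarrow> 'a) \<Rightarrow> bool" where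
  "steering S K d e \<Phi> A \<longleftrightarrow>
     continuous_on ({-d..d} \<times> K) (\<lambda>(h, y). A h y) \<and> (\<forall>y\<in>K. A 0 y = y) \<and>
     (\<forall>h\<in>{-d..d}. \<forall>y\<in>K. S y (A h y) \<and> norm (A h y - \<Phi> h y) \<le> e)"

text \<open>The error is measured against the size \<open>d\<close> of the parameter range, not against the parameter
  \<open>h\<close> itself: this is all that Brouwer's theorem needs in the end, and it allows \<open>A\<close> to depend on
  \<open>d\<close>.\<close>

definition steers ::
    "('a \<Rightarrow> 'a \<Rightarrow> bool) \<Rightarrow> 'a \<Rightarrow> real \<Rightarrow> nat \<Rightarrow> (real \<Rightarrow> 'a::euclidean_space \<Rightarrow> 'a) \<Rightarrow> bool" where
  "steers S c R m \<Phi> \<longleftrightarrow>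
     (\<forall>\<rho><R. \<forall>e>0. \<exists>d0>0. \<forall>d. 0 < d \<and> d \<le> d0 \<longrightarrow> (\<exists>A. steering S (cball c \<rho>) d (e * d^m) \<Phi> A))"

lemma steersE:
  assumes "steers S c R m \<Phi>" "\<rho> < R" "e > 0"
  obtains d0 where "d0 > 0" "\<And>d. 0 < d \<Longrightarrow> d \<le> d0 \<Longrightarrow> \<exists>A. steering S (cball c \<rho>) d (e * d^m) \<Phi> A"
  using assms unfolding steers_def by meson

lemma continuous_on_steering:
  assumes "steering S K d e \<Phi> A" "continuous_on P f" "continuous_on P g"
    "\<And>p. p \<in> P \<Longrightarrow> \<bar>f p\<bar> \<le> d" "\<And>p. p \<in> P \<Longrightarrow> g p \<in> K"
  shows "continuous_on P (\<lambda>p. A (f p) (g p))"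
proof -
  have "continuous_on ({-d..d} \<times> K) (\<lambda>(h, y). A h y)"
    using assms(1) by (simp add: steering_def)
  from continuous_on_compose2[OF this, of P "\<lambda>p. (f p, g p)"] show ?thesis
    using assms(2-5) by (fastforce intro: continuous_on_Pair)
qed

lemma steering_cong:
  assumes "steering S K d e \<Phi> A" "\<And>h y. y \<in> K \<Longrightarrow> \<Phi> h y = \<Psi> h y"
  shows "steering S K d e \<Psi> A"
  using assms by (simp add: steering_def)

lemma steers_cong:
  assumes "steers S c R m \<Phi>" "\<And>h y. y \<in> cball c R \<Longrightarrow> \<Phi> h y = \<Psi> h y"
  shows "steers S c R m \<Psi>"
  unfolding steers_def
proof (intro allI impI)
  fix \<rho> e :: real assume *: "\<rho> < R" "0 < e"
  have eq: "\<Phi> h y = \<Psi> h y" if "y \<in> cball c \<rho>" for h y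
    using assms(2) that * by auto
  from steersE[OF assms(1) *] obtain d0 where "d0 > 0"
    "\<And>d. 0 < d \<Longrightarrow> d \<le> d0 \<Longrightarrow> \<exists>A. steering S (cball c \<rho>) d (e * d^m) \<Phi> A" by blast
  then show "\<exists>d0>0. \<forall>d. 0 < d \<and> d \<le> d0 \<longrightarrow> (\<exists>A. steering S (cball c \<rho>) d (e * d ^ m) \<Psi> A)"
    using steering_cong[of S "cball c \<rho>" _ _ \<Phi> _ \<Psi>] eq by blast
qed

text \<open>Up to small errors \<open>Z (p k) = Z y + k u D (Z y)\<close>, so summing
  \<open>u Z (p k)\<close> over \<open>k < N\<close> produces the coefficient
  \<open>u^2 N (N - 1) / 2\<close> of \<open>D (Z y)\<close>. Replacing it by
  \<open>(N u)^2 / 2\<close> costs \<open>N u^2 / 2\<close>, which accounts for the last term, with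
  \<open>q\<close>. A step may err by \<open>e * q\<close>; all steps together err by
  \<open>e * d\<close>, which is of second order once \<open>e\<close> is small compared with
  \<open>d\<close>. The time \<open>u\<close> is signed, with \<open>q\<close> bounding its
  size.\<close>

lemma euler_polygon_second_order:
  fixes Z :: "'a::euclidean_space \<Rightarrow> 'a"
  assumes D: "linear D" "\<And>v. norm (D v) \<le> M * norm v" and "norm (Z y) \<le> M"
    and near: "\<And>k. k \<le> N \<Longrightarrow> norm (p k - y) \<le> k * q * (M + 1)"
    and lip: "\<And>k. k \<le> N \<Longrightarrow> norm (Z (p k) - Z y) \<le> M * norm (p k - y)"
    and taylor: "\<And>k. k \<le> N \<Longrightarrow> norm (Z (p k) - Z y - D (p k - y)) \<le> \<eta> * norm (p k - y)"
    and step: "\<And>k. k < N \<Longrightarrow> norm (p (Suc k) - p k - u *\<^sub>R Z (p k)) \<le> e * q"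
    and "p 0 = y" "\<bar>u\<bar> \<le> q" and d: "N * q = d" and "0 \<le> M" "0 \<le> e" "0 \<le> \<eta>"
  shows "norm (p N - (y + (N * u) *\<^sub>R Z y + ((N * u)\<^sup>2 / 2) *\<^sub>R D (Z y)))
    \<le> d * (\<eta> * ((M + 1) * d) + M * (d * (M * (M + 1) * d + e)) + e) + d * q * M\<^sup>2"
proof -
  interpret linear D by fact
  have "q \<ge> 0" "d \<ge> 0" using d \<open>\<bar>u\<bar> \<le> q\<close> by auto
  have kq: "k * q \<le> d" if "k \<le> N" for k
    using that \<open>q \<ge> 0\<close> unfolding d[symmetric] by (simp add: mult_right_mono)
  have near': "norm (p k - y) \<le> (M + 1) * d" if "k \<le> N" for k
    unfolding mult.commute[of "M + 1"] using \<open>0 \<le> M\<close>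
    by (intro order_trans[OF near[OF that] mult_right_mono[OF kq[OF that]]]) auto
  \<comment> \<open>A cruder expansion of the position, needed as the argument of \<open>D\<close>
    in the finer one.\<close>
  have first: "norm (p k - y - (k * u) *\<^sub>R Z y) \<le> k * q * (M * (M + 1) * d + e)" if "k \<le> N" for k
    using that
  proof (induction k)
    case (Suc k)
    have "norm (u *\<^sub>R (Z (p k) - Z y)) \<le> q * (M * ((M + 1) * d))"
      unfolding norm_scaleR
      using lip[of k] near'[of k] mult_left_mono[OF near'[of k] \<open>0 \<le> M\<close>] Suc.prems \<open>\<bar>u\<bar> \<le> q\<close>
      by (intro mult_mono) auto
    moreover have "p (Suc k) - y - (Suc k * u) *\<^sub>R Z y = (p k - y - (k * u) *\<^sub>R Z y)
        + (u *\<^sub>R (Z (p k) - Z y) + (p (Suc k) - p k - u *\<^sub>R Z (p k)))"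
      by (simp add: algebra_simps)
    moreover have "norm (p k - y - (k * u) *\<^sub>R Z y) \<le> k * q * (M * (M + 1) * d + e)"
      "norm (p (Suc k) - p k - u *\<^sub>R Z (p k)) \<le> e * q"
      using Suc step[of k] by auto
    moreover have "Suc k * q * (M * (M + 1) * d + e)
        = k * q * (M * (M + 1) * d + e) + (q * (M * ((M + 1) * d)) + e * q)"
      by (simp add: algebra_simps)
    ultimately show ?case by (metis (no_types, lifting) norm_triangle_mono)
  qed (simp add: \<open>p 0 = y\<close>)
  \<comment> \<open>Bounds the distance from \<open>Z (p k)\<close> to its prediction
    \<open>Z y + k u D (Z y)\<close>: the Taylor remainder plus \<open>D\<close> applied to the
    error in \<open>first\<close>.\<close>
  define b where "b = \<eta> * ((M + 1) * d) + M * (d * (M * (M + 1) * d + e))"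
  have second: "norm (p k - y - (k * u) *\<^sub>R Z y - (u\<^sup>2 * (k * (real k - 1) / 2)) *\<^sub>R D (Z y))
      \<le> k * q * (b + e)" if "k \<le> N" for k
    using that
  proof (induction k)
    case (Suc k)
    have "norm (Z (p k) - Z y - (k * u) *\<^sub>R D (Z y)) \<le> b"
    proof -
      have "norm (Z (p k) - Z y - D (p k - y)) \<le> \<eta> * ((M + 1) * d)"
        using taylor[of k] mult_left_mono[OF near'[of k] \<open>0 \<le> \<eta>\<close>] Suc.prems by linarith
      moreover have "norm (D (p k - y - (k * u) *\<^sub>R Z y)) \<le> M * (d * (M * (M + 1) * d + e))"
      proof (rule order_trans[OF D(2) mult_left_mono])
        have "0 \<le> M * (M + 1) * d + e" using \<open>0 \<le> M\<close> \<open>0 \<le> e\<close> \<open>0 \<le> d\<close> by simp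
        from mult_right_mono[OF kq[of k] this]
        show "norm (p k - y - (k * u) *\<^sub>R Z y) \<le> d * (M * (M + 1) * d + e)"
          using first[of k] Suc.prems by simp
      qed fact
      moreover have "Z (p k) - Z y - (k * u) *\<^sub>R D (Z y)
          = (Z (p k) - Z y - D (p k - y)) + D (p k - y - (k * u) *\<^sub>R Z y)"
        by (simp add: diff scale)
      ultimately show ?thesis unfolding b_def by (metis norm_triangle_mono)
    qed
    then have "norm (u *\<^sub>R (Z (p k) - Z y - (k * u) *\<^sub>R D (Z y))) \<le> q * b"
      unfolding norm_scaleR using \<open>\<bar>u\<bar> \<le> q\<close> \<open>q \<ge> 0\<close> by (intro mult_mono) auto
    moreover have "p (Suc k) - y - (Suc k * u) *\<^sub>R Z y
        - (u\<^sup>2 * (Suc k * (real (Suc k) - 1) / 2)) *\<^sub>R D (Z y)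
      = (p k - y - (k * u) *\<^sub>R Z y - (u\<^sup>2 * (k * (real k - 1) / 2)) *\<^sub>R D (Z y))
        + (u *\<^sub>R (Z (p k) - Z y - (k * u) *\<^sub>R D (Z y)) + (p (Suc k) - p k - u *\<^sub>R Z (p k)))"
    proof -
      have "u\<^sup>2 * (Suc k * (real (Suc k) - 1) / 2) = u\<^sup>2 * (k * (real k - 1) / 2) + u * (k * u)"
        by (simp add: field_simps power2_eq_square)
      then show ?thesis by (simp only: scaleR_add_left) (simp add: algebra_simps)
    qed
    moreover have "norm (p k - y - (k * u) *\<^sub>R Z y - (u\<^sup>2 * (k * (real k - 1) / 2)) *\<^sub>R D (Z y))
        \<le> k * q * (b + e)" "norm (p (Suc k) - p k - u *\<^sub>R Z (p k)) \<le> e * q"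
      using Suc step[of k] by auto
    moreover have "Suc k * q * (b + e) = k * q * (b + e) + (q * b + e * q)"
      by (simp add: algebra_simps)
    ultimately show ?case by (metis (no_types, lifting) norm_triangle_mono)
  qed (simp add: \<open>p 0 = y\<close>)
  have "norm ((N * u * u / 2) *\<^sub>R D (Z y)) \<le> d * q * M\<^sup>2"
  proof -
    have "\<bar>N * u * u / 2\<bar> \<le> N * q * q"
    proof -
      have "real N * (\<bar>u\<bar> * \<bar>u\<bar>) \<le> real N * (q * q)"
        using \<open>\<bar>u\<bar> \<le> q\<close> \<open>q \<ge> 0\<close> by (intro mult_left_mono mult_mono) auto
      moreover have "\<bar>N * u * u / 2\<bar> = real N * (\<bar>u\<bar> * \<bar>u\<bar>) / 2"
        by (simp add: abs_mult)
      moreover have "0 \<le> real N * (\<bar>u\<bar> * \<bar>u\<bar>)" by simp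
      ultimately show ?thesis unfolding mult.assoc by linarith
    qed
    moreover have "norm (D (Z y)) \<le> M\<^sup>2"
      using D(2)[of "Z y"] mult_left_mono[OF \<open>norm (Z y) \<le> M\<close> \<open>0 \<le> M\<close>] by (simp add: power2_eq_square)
    ultimately show ?thesis
      unfolding norm_scaleR d[symmetric] by (intro mult_mono) (use \<open>q \<ge> 0\<close> in auto)
  qed
  moreover have "p N - (y + (N * u) *\<^sub>R Z y + ((N * u)\<^sup>2 / 2) *\<^sub>R D (Z y))
      = (p N - y - (N * u) *\<^sub>R Z y - (u\<^sup>2 * (N * (real N - 1) / 2)) *\<^sub>R D (Z y))
        - (N * u * u / 2) *\<^sub>R D (Z y)"
  proof -
    have "(N * u)\<^sup>2 / 2 = u\<^sup>2 * (N * (real N - 1) / 2) + N * u * u / 2"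
      by (simp add: field_simps power2_eq_square)
    then show ?thesis by (simp only: scaleR_add_left diff_diff_eq add.assoc)
  qed
  moreover have "norm (p N - y - (N * u) *\<^sub>R Z y - (u\<^sup>2 * (N * (real N - 1) / 2)) *\<^sub>R D (Z y))
      \<le> d * (b + e)"
    using second[of N] d by simp
  ultimately have "norm (p N - (y + (N * u) *\<^sub>R Z y + ((N * u)\<^sup>2 / 2) *\<^sub>R D (Z y)))
      \<le> d * (b + e) + d * q * M\<^sup>2"
    using norm_triangle_le_diff by (smt (verit, best))
  then show ?thesis by (simp add: b_def)
qed

text \<open>First order steering is available at every small scale, with any relative accuracy.
  Hence a move of size \<open>d\<close> can be cut into \<open>N\<close> moves of size
  \<open>q = d / N\<close>, whose accuracy is chosen depending on \<open>d\<close>. The resulting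
  map depends on \<open>d\<close>, as the definition of \<open>steers\<close> permits.\<close>

lemma steers_second_order:
  fixes Z :: "'a::euclidean_space \<Rightarrow> 'a"
  assumes "reflp S" "transp S" and Z: "uniformly_C1 (cball c R) Z D"
    and "steers S c R 1 (\<lambda>h y. y + h *\<^sub>R Z y)"
  shows "steers S c R 2 (\<lambda>h y. y + h *\<^sub>R Z y + (h\<^sup>2 / 2) *\<^sub>R D y (Z y))"
  unfolding steers_def
proof (intro allI impI)
  fix \<rho> e :: real assume "\<rho> < R" "0 < e"
  \<comment> \<open>The polygon may leave \<open>cball c \<rho>\<close>, so its steps are taken from
    a larger ball that is still smaller than \<open>cball c R\<close>.\<close>
  define \<rho>' where "\<rho>' = (\<rho> + R) / 2"
  have \<rho>': "\<rho> < \<rho>'" "\<rho>' < R" using \<open>\<rho> < R\<close> by (auto simp: \<rho>'_def)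
  obtain M where "M \<ge> 1" and M: "\<And>y. y \<in> cball c R \<Longrightarrow> norm (Z y) \<le> M"
    "\<And>y. y \<in> cball c R \<Longrightarrow> linear (D y)"
    "\<And>y v. y \<in> cball c R \<Longrightarrow> norm (D y v) \<le> M * norm v"
    "\<And>y z. y \<in> cball c R \<Longrightarrow> z \<in> cball c R \<Longrightarrow> norm (Z z - Z y) \<le> M * norm (z - y)"
    using uniformly_C1_bounds[OF Z] by blast
  define \<eta> where "\<eta> = e / (8 * (M + 1))"
  have "\<eta> > 0" using \<open>0 < e\<close> \<open>M \<ge> 1\<close> by (simp add: \<eta>_def)
  obtain \<delta> where "\<delta> > 0" and \<delta>: "\<And>y z. y \<in> cball c R \<Longrightarrow> z \<in> cball c R \<Longrightarrow> norm (z - y) \<le> \<delta> \<Longrightarrow>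
      norm (Z z - Z y - D y (z - y)) \<le> \<eta> * norm (z - y)"
    using uniformly_C1_modulus[OF Z \<open>\<eta> > 0\<close>] by metis
  \<comment> \<open>A step moves a point by at most \<open>q * (M + 1)\<close>: \<open>M\<close>
    from the field and \<open>1\<close> from the error. The whole polygon thus stays within
    \<open>(M + 1) * d\<close> of its start, inside both the Taylor radius \<open>\<delta>\<close>
    and the larger ball. The fractions \<open>e / 8\<close> here and below split the final bound:
    five terms, each at most \<open>e * d\<^sup>2 / 8\<close>.\<close>
  define d0 where "d0 = Min {1, \<delta> / (M + 1), (\<rho>' - \<rho>) / (M + 1), e / (8 * (M\<^sup>2 * (M + 1)))}"
  have "d0 > 0"
    using \<open>M \<ge> 1\<close> \<open>\<delta> > 0\<close> \<rho>' \<open>0 < e\<close> by (auto simp: d0_def intro!: divide_pos_pos mult_pos_pos)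
  have "\<exists>A. steering S (cball c \<rho>) d (e * d\<^sup>2) (\<lambda>h y. y + h *\<^sub>R Z y + (h\<^sup>2 / 2) *\<^sub>R D y (Z y)) A"
    if "0 < d" "d \<le> d0" for d
  proof -
    have d: "d \<le> 1" "(M + 1) * d \<le> \<delta>" "(M + 1) * d \<le> \<rho>' - \<rho>" "M\<^sup>2 * (M + 1) * d \<le> e / 8"
    proof -
      have "M\<^sup>2 * (M + 1) > 0" using \<open>M \<ge> 1\<close> by (intro mult_pos_pos) auto
      then show "M\<^sup>2 * (M + 1) * d \<le> e / 8"
        using that(2) unfolding d0_def by (simp add: pos_le_divide_eq mult_ac)
      show "d \<le> 1" "(M + 1) * d \<le> \<delta>" "(M + 1) * d \<le> \<rho>' - \<rho>"
        using that(2) \<open>M \<ge> 1\<close> unfolding d0_def by (auto simp: pos_le_divide_eq mult.commute)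
    qed
    \<comment> \<open>Chosen after \<open>d\<close>: step errors add up to \<open>e1 * d\<close>, so
      \<open>e1\<close> has to be of order \<open>d\<close>. The step size \<open>q\<close> is then
      pushed below the threshold \<open>d1\<close> that belongs to \<open>e1\<close>.\<close>
    define e1 where "e1 = min 1 (e * d / (8 * M))"
    have e1: "0 < e1" "e1 \<le> 1" "M * e1 \<le> e * d / 8"
      using \<open>0 < e\<close> \<open>0 < d\<close> \<open>M \<ge> 1\<close> by (auto simp: e1_def min_def field_simps)
    have e1': "e1 \<le> M * e1" using \<open>M \<ge> 1\<close> e1(1) by simp
    obtain d1 where "d1 > 0" and d1: "\<And>q. 0 < q \<Longrightarrow> q \<le> d1 \<Longrightarrow>
        \<exists>A. steering S (cball c \<rho>') q (e1 * q^1) (\<lambda>h y. y + h *\<^sub>R Z y) A"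
      using steersE[OF assms(4) \<rho>'(2) e1(1)] by metis
    define b where "b = min d1 (e * d / (8 * M\<^sup>2))"
    have "b > 0" using \<open>d1 > 0\<close> \<open>0 < e\<close> \<open>0 < d\<close> \<open>M \<ge> 1\<close> by (simp add: b_def)
    obtain N where N: "d / b < real N" using reals_Archimedean2 by blast
    have "N > 0" using N \<open>0 < d\<close> \<open>b > 0\<close> by (cases N) (auto simp: field_simps)
    define q where "q = d / N"
    have Nq: "N * q = d" and "q > 0" using \<open>N > 0\<close> \<open>0 < d\<close> by (auto simp: q_def)
    have "q \<le> b" using N \<open>b > 0\<close> \<open>N > 0\<close> by (simp add: q_def field_simps)
    then have "q \<le> d1" "q * M\<^sup>2 \<le> e * d / 8"
      using \<open>M \<ge> 1\<close> by (auto simp: b_def field_simps)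
    then obtain B where B: "steering S (cball c \<rho>') q (e1 * q) (\<lambda>h y. y + h *\<^sub>R Z y) B"
      using d1[OF \<open>q > 0\<close>] by auto
    define A where "A h = (B (h / N) ^^ N)" for h
    have u: "\<bar>h / N\<bar> \<le> q" if "\<bar>h\<bar> \<le> d" for h
      using that \<open>N > 0\<close> by (simp add: q_def divide_right_mono)
    have Bstep: "S y (B w y)" "norm (B w y - y - w *\<^sub>R Z y) \<le> e1 * q"
      if "\<bar>w\<bar> \<le> q" "y \<in> cball c \<rho>'" for w y
      using B that by (auto simp: steering_def abs_le_iff diff_diff_eq)
    \<comment> \<open>Distance, membership and reachability go through one induction, because the
      next step may be taken only from a point known to lie in the larger ball.\<close>
    have near: "norm ((B w ^^ k) y - y) \<le> k * q * (M + 1) \<and> (B w ^^ k) y \<in> cball c \<rho>' \<and> S y ((B w ^^ k) y)"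
      if "\<bar>w\<bar> \<le> q" "y \<in> cball c \<rho>" "k \<le> N" for w y k
      using that(3)
    proof (induction k)
      case 0
      then show ?case using that(2) \<rho>' \<open>reflp S\<close> by (auto simp: reflpD)
    next
      case (Suc k)
      define z where "z = (B w ^^ k) y"
      have z: "norm (z - y) \<le> k * q * (M + 1)" "z \<in> cball c \<rho>'" "S y z"
        using Suc by (auto simp: z_def)
      have "z \<in> cball c R" using z(2) \<rho>'(2) by auto
      have "norm (w *\<^sub>R Z z) \<le> q * M"
        unfolding norm_scaleR using M(1)[OF \<open>z \<in> cball c R\<close>] \<open>\<bar>w\<bar> \<le> q\<close> \<open>q > 0\<close> by (intro mult_mono) auto
      moreover have "norm (B w z - z - w *\<^sub>R Z z) \<le> q"
        using Bstep(2)[OF that(1) z(2)] mult_right_mono[OF e1(2), of q] \<open>q > 0\<close> by linarith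
      moreover have "B w z - y = (z - y) + (w *\<^sub>R Z z + (B w z - z - w *\<^sub>R Z z))" by simp
      moreover have "Suc k * q * (M + 1) = k * q * (M + 1) + (q * M + q)" by (simp add: algebra_simps)
      ultimately have *: "norm (B w z - y) \<le> Suc k * q * (M + 1)"
        using z(1) by (metis norm_triangle_mono)
      also have "\<dots> \<le> d * (M + 1)"
        using Suc.prems \<open>q > 0\<close> \<open>M \<ge> 1\<close> unfolding Nq[symmetric] by (intro mult_right_mono) auto
      finally have "norm (B w z - y) \<le> \<rho>' - \<rho>" using d(3) by (simp add: mult.commute)
      then have "B w z \<in> cball c \<rho>'"
        using that(2) norm_triangle_ineq[of "B w z - y" "y - c"]
        by (simp add: dist_norm norm_minus_commute)
      then show ?case
        using * Bstep(1)[OF that(1) z(2)] z(3) \<open>transp S\<close> by (auto simp: z_def dest: transpD)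
    qed
    have est: "norm (A h y - (y + h *\<^sub>R Z y + (h\<^sup>2 / 2) *\<^sub>R D y (Z y))) \<le> e * d\<^sup>2"
      if h: "\<bar>h\<bar> \<le> d" and y: "y \<in> cball c \<rho>" for h y
    proof -
      have yR: "y \<in> cball c R" using y \<open>\<rho> < R\<close> by auto
      define p where "p k = (B (h / N) ^^ k) y" for k
      have p: "norm (p k - y) \<le> k * q * (M + 1)" "p k \<in> cball c \<rho>'" "p k \<in> cball c R"
        "norm (p k - y) \<le> \<delta>" if "k \<le> N" for k
      proof -
        show *: "norm (p k - y) \<le> k * q * (M + 1)" "p k \<in> cball c \<rho>'"
          using near[OF u[OF h] y that] by (auto simp: p_def)
        show "p k \<in> cball c R" using *(2) \<rho>'(2) by auto
        have "k * q * (M + 1) \<le> d * (M + 1)"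
          using that \<open>q > 0\<close> \<open>M \<ge> 1\<close> unfolding Nq[symmetric] by (intro mult_right_mono) auto
        then show "norm (p k - y) \<le> \<delta>" using *(1) d(2) by (simp add: mult.commute)
      qed
      have "norm (p N - (y + (N * (h / N)) *\<^sub>R Z y + ((N * (h / N))\<^sup>2 / 2) *\<^sub>R D y (Z y)))
          \<le> d * (\<eta> * ((M + 1) * d) + M * (d * (M * (M + 1) * d + e1)) + e1) + d * q * M\<^sup>2"
      proof (rule euler_polygon_second_order)
        show "norm (p (Suc k) - p k - (h / N) *\<^sub>R Z (p k)) \<le> e1 * q" if "k < N" for k
          using Bstep(2)[OF u[OF h] p(2)[of k]] that by (simp add: p_def)
      qed (use M \<delta> yR p u[OF h] Nq \<open>M \<ge> 1\<close> e1 \<open>\<eta> > 0\<close> in \<open>auto simp: p_def\<close>)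
      also have "\<dots> \<le> d * (e * d / 8 + (e * d / 8 + e * d / 8) + e * d / 8) + d * (e * d / 8)"
      proof -
        have "\<eta> * (M + 1) = e / 8" using \<open>M \<ge> 1\<close> by (simp add: \<eta>_def field_simps)
        then have "\<eta> * (M + 1) * d = e / 8 * d" by (simp only:)
        then have "\<eta> * ((M + 1) * d) = e * d / 8" by (simp only: mult.assoc times_divide_eq_left)
        moreover have "M * (d * (M * (M + 1) * d + e1)) \<le> e * d / 8 + e * d / 8"
        proof -
          have "M * (d * (M * (M + 1) * d + e1)) = d * (M\<^sup>2 * (M + 1) * d) + d * (M * e1)"
            by (simp add: algebra_simps power2_eq_square)
          moreover have "d * (M\<^sup>2 * (M + 1) * d) \<le> d * (e / 8)" using d(4) \<open>0 < d\<close> by (intro mult_left_mono) auto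
          moreover have "d * (M * e1) \<le> 1 * (e * d / 8)"
            using d(1) e1 \<open>0 < d\<close> \<open>M \<ge> 1\<close> by (intro mult_mono) auto
          ultimately show ?thesis by (simp add: mult.commute)
        qed
        moreover have "e1 \<le> e * d / 8" using e1 e1' by linarith
        ultimately have "\<eta> * ((M + 1) * d) + M * (d * (M * (M + 1) * d + e1)) + e1
            \<le> e * d / 8 + (e * d / 8 + e * d / 8) + e * d / 8" by linarith
        from mult_left_mono[OF this, of d] mult_left_mono[OF \<open>q * M\<^sup>2 \<le> e * d / 8\<close>, of d]
        show ?thesis using \<open>0 < d\<close> unfolding mult.assoc[of d q] by linarith
      qed
      also have "\<dots> \<le> e * d\<^sup>2" using \<open>0 < e\<close> \<open>0 < d\<close> by (simp add: power2_eq_square)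
      finally show ?thesis using \<open>N > 0\<close> by (simp add: p_def A_def)
    qed
    have cont: "continuous_on ({-d..d} \<times> cball c \<rho>) (\<lambda>p. (B (fst p / N) ^^ k) (snd p))" if "k \<le> N" for k
      using that
    proof (induction k)
      case 0
      then show ?case by (auto intro: continuous_intros)
    next
      case (Suc k)
      have "continuous_on ({-d..d} \<times> cball c \<rho>) (\<lambda>p. B (fst p / N) ((B (fst p / N) ^^ k) (snd p)))"
      proof (rule continuous_on_steering[OF B])
        show "continuous_on ({-d..d} \<times> cball c \<rho>) (\<lambda>p. (B (fst p / real N) ^^ k) (snd p))"
          using Suc by simp
        show "\<bar>fst p / real N\<bar> \<le> q" if "p \<in> {-d..d} \<times> cball c \<rho>" for p
          using that by (intro u) auto
        show "(B (fst p / real N) ^^ k) (snd p) \<in> cball c \<rho>'" if "p \<in> {-d..d} \<times> cball c \<rho>" for p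
          using that near[of "fst p / N" "snd p" k] u[of "fst p"] Suc.prems by auto
      qed (use \<open>N > 0\<close> in \<open>auto intro!: continuous_intros\<close>)
      then show ?case by simp
    qed
    have A0: "A 0 y = y" if "y \<in> cball c \<rho>" for y
    proof -
      have "B 0 y = y" using B that \<rho>' by (auto simp: steering_def)
      then have "(B 0 ^^ k) y = y" for k by (induction k) auto
      then show ?thesis by (simp add: A_def)
    qed
    show ?thesis
    proof
      show "steering S (cball c \<rho>) d (e * d\<^sup>2) (\<lambda>h y. y + h *\<^sub>R Z y + (h\<^sup>2 / 2) *\<^sub>R D y (Z y)) A"
        unfolding steering_def
      proof (intro conjI ballI)
        show "continuous_on ({-d..d} \<times> cball c \<rho>) (\<lambda>(h, y). A h y)"
          using cont[OF order_refl] by (simp add: A_def split_beta)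
      next
        fix h y assume "h \<in> {-d..d}" "y \<in> cball c \<rho>"
        then show "S y (A h y)" using near[OF u, of h y N] by (auto simp: A_def)
      qed (use est A0 in auto)
    qed
  qed
  then show "\<exists>d0>0. \<forall>d. 0 < d \<and> d \<le> d0 \<longrightarrow>
      (\<exists>A. steering S (cball c \<rho>) d (e * d\<^sup>2) (\<lambda>h y. y + h *\<^sub>R Z y + (h\<^sup>2 / 2) *\<^sub>R D y (Z y)) A)"
    using \<open>d0 > 0\<close> by blast
qed

text \<open>Second order expansions compose: if \<open>y = y0 + t v + t^2 w\<close> up to a small
  error, then \<open>F y = F y0 + t D y0 v + o(\<tau>)\<close>, and a move along \<open>F\<close>
  for time \<open>\<sigma> * t\<close> adds \<open>\<sigma> F y0\<close> to the linear coefficient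
  and \<open>\<sigma> D y0 v + (\<sigma>^2 / 2) D y0 (F y0)\<close> to the quadratic one. The
  thresholds depend on \<open>v\<close> and \<open>w\<close> only through the bound
  \<open>C\<close>, which makes them uniform in the base point.\<close>

lemma second_order_step:
  fixes F :: "'a::euclidean_space \<Rightarrow> 'a"
  assumes F: "uniformly_C1 B F D" and "e > 0" "C \<ge> 0" "\<bar>\<sigma>\<bar> \<le> 1"
  obtains e' \<tau>0 where "0 < e'" "e' \<le> 1" "\<tau>0 > 0"
    "\<And>\<tau> t y0 y y' v w. 0 < \<tau> \<Longrightarrow> \<tau> \<le> \<tau>0 \<Longrightarrow> \<bar>t\<bar> \<le> \<tau> \<Longrightarrow> y0 \<in> B \<Longrightarrow> y \<in> B \<Longrightarrow> norm v \<le> C \<Longrightarrow> norm w \<le> C \<Longrightarrow>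
      norm (y - (y0 + t *\<^sub>R v + t\<^sup>2 *\<^sub>R w)) \<le> e' * \<tau>\<^sup>2 \<Longrightarrow>
      norm (y' - (y + (\<sigma> * t) *\<^sub>R F y + ((\<sigma> * t)\<^sup>2 / 2) *\<^sub>R D y (F y))) \<le> e' * \<tau>\<^sup>2 \<Longrightarrow>
      norm (y' - (y0 + t *\<^sub>R (v + \<sigma> *\<^sub>R F y0) + t\<^sup>2 *\<^sub>R (w + \<sigma> *\<^sub>R D y0 v + (\<sigma>\<^sup>2 / 2) *\<^sub>R D y0 (F y0)))) \<le> e * \<tau>\<^sup>2"
proof -
  obtain M where "M \<ge> 1" and M: "\<And>y. y \<in> B \<Longrightarrow> norm (F y) \<le> M"
    "\<And>y. y \<in> B \<Longrightarrow> linear (D y)" "\<And>y v. y \<in> B \<Longrightarrow> norm (D y v) \<le> M * norm v"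
    using uniformly_C1_bounds[OF F] by metis
  \<comment> \<open>\<open>2 * C + 1\<close> bounds \<open>norm (y - y0) / \<tau>\<close>, so the
    Taylor remainder becomes at most \<open>e / 8 * \<tau>\<close>.\<close>
  define \<eta> where "\<eta> = e / (8 * (2 * C + 1))"
  have "\<eta> > 0" using assms by (simp add: \<eta>_def)
  have \<eta>: "\<eta> * (2 * C + 1) = e / 8" using \<open>C \<ge> 0\<close> by (simp add: \<eta>_def field_simps)
  have "\<eta> \<le> e / 8" 
  proof -
    have "\<eta> * 1 \<le> \<eta> * (2 * C + 1)" using \<open>\<eta> > 0\<close> \<open>C \<ge> 0\<close> by (intro mult_left_mono) auto
    then show ?thesis using \<eta> by linarith
  qed
  obtain \<delta> where "\<delta> > 0" and \<delta>:
    "\<And>y z. y \<in> B \<Longrightarrow> z \<in> B \<Longrightarrow> norm (z - y) \<le> \<delta> \<Longrightarrow> norm (F z - F y - D y (z - y)) \<le> \<eta> * norm (z - y)"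
    "\<And>y z. y \<in> B \<Longrightarrow> z \<in> B \<Longrightarrow> norm (z - y) \<le> \<delta> \<Longrightarrow> norm (D z (F z) - D y (F y)) \<le> \<eta>"
    using uniformly_C1_modulus[OF F \<open>\<eta> > 0\<close>] by metis
  define \<tau>0 where "\<tau>0 = Min {1, \<delta> / (2 * C + 1), e / 4 / (M * (C + 1))}"
  show ?thesis
  proof (rule that[of "min 1 (e / 8)" \<tau>0])
    show "\<tau>0 > 0" using \<open>C \<ge> 0\<close> \<open>\<delta> > 0\<close> \<open>e > 0\<close> \<open>M \<ge> 1\<close>
      by (auto simp: \<tau>0_def intro!: divide_pos_pos mult_pos_pos)
    fix \<tau> t y0 y y' v w
    assume \<tau>: "0 < \<tau>" "\<tau> \<le> \<tau>0" "\<bar>t\<bar> \<le> \<tau>" and B: "y0 \<in> B" "y \<in> B" and C: "norm v \<le> C" "norm w \<le> C"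
      and 1: "norm (y - (y0 + t *\<^sub>R v + t\<^sup>2 *\<^sub>R w)) \<le> min 1 (e / 8) * \<tau>\<^sup>2"
      and 2: "norm (y' - (y + (\<sigma> * t) *\<^sub>R F y + ((\<sigma> * t)\<^sup>2 / 2) *\<^sub>R D y (F y))) \<le> min 1 (e / 8) * \<tau>\<^sup>2"
    have \<tau>': "\<tau> \<le> 1" "(2 * C + 1) * \<tau> \<le> \<delta>" "M * (C + 1) * \<tau> \<le> e / 4"
    proof -
      have "M * (C + 1) > 0" "2 * C + 1 > 0" using \<open>M \<ge> 1\<close> \<open>C \<ge> 0\<close> by auto
      moreover have "\<tau> \<le> 1" "\<tau> \<le> \<delta> / (2 * C + 1)" "\<tau> \<le> e / 4 / (M * (C + 1))"
        using \<tau>(2) by (simp_all add: \<tau>0_def)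
      ultimately show "\<tau> \<le> 1" "(2 * C + 1) * \<tau> \<le> \<delta>" "M * (C + 1) * \<tau> \<le> e / 4"
        by (simp_all only: pos_le_divide_eq mult.commute)
    qed
    interpret linear "D y0" by (rule M(2)[OF B(1)])
    have t2: "t\<^sup>2 \<le> \<tau>\<^sup>2" using \<tau>(1,3) by (simp add: abs_le_square_iff[symmetric])
    have "\<tau>\<^sup>2 \<le> \<tau>" using \<tau>(1) \<tau>'(1) by (simp add: power2_eq_square mult_left_le)
    have err: "min 1 (e / 8) * \<tau>\<^sup>2 \<le> \<tau>\<^sup>2" "min 1 (e / 8) * \<tau>\<^sup>2 \<le> e / 8 * \<tau>\<^sup>2"
      using mult_right_mono[of "min 1 (e / 8)" 1 "\<tau>\<^sup>2"] mult_right_mono[of "min 1 (e / 8)" "e / 8" "\<tau>\<^sup>2"]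
      by auto
    have dev: "norm (y - y0 - t *\<^sub>R v) \<le> (C + 1) * \<tau>\<^sup>2"
    proof -
      have "norm (t\<^sup>2 *\<^sub>R w) \<le> \<tau>\<^sup>2 * C" unfolding norm_scaleR using t2 C by (intro mult_mono) auto
      moreover have "y - y0 - t *\<^sub>R v = t\<^sup>2 *\<^sub>R w + (y - (y0 + t *\<^sub>R v + t\<^sup>2 *\<^sub>R w))" by simp
      moreover have "(C + 1) * \<tau>\<^sup>2 = \<tau>\<^sup>2 * C + \<tau>\<^sup>2" by (simp add: algebra_simps)
      moreover have "norm (y - (y0 + t *\<^sub>R v + t\<^sup>2 *\<^sub>R w)) \<le> \<tau>\<^sup>2" using 1 err(1) by linarith
      ultimately show ?thesis by (metis norm_triangle_mono)
    qed
    have \<Delta>: "norm (y - y0) \<le> (2 * C + 1) * \<tau>"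
    proof -
      have "norm (t *\<^sub>R v) \<le> \<tau> * C" unfolding norm_scaleR using \<tau> C by (intro mult_mono) auto
      moreover have "y - y0 = t *\<^sub>R v + (y - y0 - t *\<^sub>R v)" by simp
      moreover have "norm (y - y0 - t *\<^sub>R v) \<le> (C + 1) * \<tau>"
        using \<open>\<tau>\<^sup>2 \<le> \<tau>\<close> \<open>C \<ge> 0\<close> by (intro order_trans[OF dev] mult_left_mono) auto
      moreover have "(2 * C + 1) * \<tau> = \<tau> * C + (C + 1) * \<tau>" by (simp add: algebra_simps)
      ultimately show ?thesis by (metis norm_triangle_mono)
    qed
    then have "norm (y - y0) \<le> \<delta>" using \<tau>'(2) by linarith
    note near = \<delta>[OF B(1,2) this]
    have 3: "norm (F y - F y0 - t *\<^sub>R D y0 v) \<le> (e / 8 + e / 4) * \<tau>"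
    proof -
      have "F y - F y0 - t *\<^sub>R D y0 v = (F y - F y0 - D y0 (y - y0)) + D y0 (y - y0 - t *\<^sub>R v)"
        by (simp add: diff scale)
      moreover have "norm (F y - F y0 - D y0 (y - y0)) \<le> e / 8 * \<tau>"
      proof -
        have "\<eta> * norm (y - y0) \<le> \<eta> * ((2 * C + 1) * \<tau>)" using \<Delta> \<open>\<eta> > 0\<close> by (intro mult_left_mono) auto
        then show ?thesis using near(1) \<eta> by (simp add: mult.assoc[symmetric])
      qed
      moreover have "norm (D y0 (y - y0 - t *\<^sub>R v)) \<le> e / 4 * \<tau>"
      proof -
        have "norm (D y0 (y - y0 - t *\<^sub>R v)) \<le> M * ((C + 1) * \<tau>\<^sup>2)"
          using M(3)[OF B(1)] dev \<open>M \<ge> 1\<close> by (meson mult_left_mono order_trans zero_le_one)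
        also have "\<dots> = (M * (C + 1) * \<tau>) * \<tau>" by (simp add: power2_eq_square)
        also have "\<dots> \<le> e / 4 * \<tau>" using \<tau>'(3) \<tau>(1) by (intro mult_right_mono) auto
        finally show ?thesis .
      qed
      ultimately show ?thesis by (metis norm_triangle_mono distrib_right)
    qed
    have st: "\<bar>\<sigma> * t\<bar> \<le> \<tau>"
      using mult_mono[OF \<open>\<bar>\<sigma>\<bar> \<le> 1\<close> \<tau>(3)] by (simp add: abs_mult)
    have 4: "norm ((\<sigma> * t) *\<^sub>R (F y - F y0 - t *\<^sub>R D y0 v)) \<le> (e / 8 + e / 4) * \<tau>\<^sup>2"
    proof -
      have "norm ((\<sigma> * t) *\<^sub>R (F y - F y0 - t *\<^sub>R D y0 v)) \<le> \<tau> * ((e / 8 + e / 4) * \<tau>)"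
        unfolding norm_scaleR using 3 st \<tau>(1) \<open>e > 0\<close> by (intro mult_mono) auto
      then show ?thesis by (simp add: power2_eq_square algebra_simps)
    qed
    have 5: "norm (((\<sigma> * t)\<^sup>2 / 2) *\<^sub>R (D y (F y) - D y0 (F y0))) \<le> e / 8 * \<tau>\<^sup>2"
    proof -
      have "(\<sigma> * t)\<^sup>2 \<le> \<tau>\<^sup>2" using st \<tau>(1) by (simp add: abs_le_square_iff[symmetric])
      then have "(\<sigma> * t)\<^sup>2 / 2 \<le> \<tau>\<^sup>2" using zero_le_power2[of \<tau>] by linarith
      then have "norm (((\<sigma> * t)\<^sup>2 / 2) *\<^sub>R (D y (F y) - D y0 (F y0))) \<le> \<tau>\<^sup>2 * (e / 8)"
        unfolding norm_scaleR using near(2) \<open>\<eta> \<le> e / 8\<close> by (intro mult_mono) auto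
      then show ?thesis by (simp add: mult.commute)
    qed
    \<comment> \<open>Error of the new move, error of the old expansion, and the effect of
      evaluating \<open>F\<close> and \<open>D y (F y)\<close> at \<open>y\<close> instead of at
      \<open>y0\<close>.\<close>
    have eq: "y' - (y0 + t *\<^sub>R (v + \<sigma> *\<^sub>R F y0) + t\<^sup>2 *\<^sub>R (w + \<sigma> *\<^sub>R D y0 v + (\<sigma>\<^sup>2 / 2) *\<^sub>R D y0 (F y0)))
      = (y' - (y + (\<sigma> * t) *\<^sub>R F y + ((\<sigma> * t)\<^sup>2 / 2) *\<^sub>R D y (F y)))
        + (y - (y0 + t *\<^sub>R v + t\<^sup>2 *\<^sub>R w))
        + ((\<sigma> * t) *\<^sub>R (F y - F y0 - t *\<^sub>R D y0 v) + ((\<sigma> * t)\<^sup>2 / 2) *\<^sub>R (D y (F y) - D y0 (F y0)))" (is "_ = ?r")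
      by (simp add: algebra_simps power2_eq_square)
    have le1: "norm (?r) \<le> (e / 8 * \<tau>\<^sup>2 + e / 8 * \<tau>\<^sup>2) + ((e / 8 + e / 4) * \<tau>\<^sup>2 + e / 8 * \<tau>\<^sup>2)"
      using 1 2 4 5 err(2) by (intro norm_triangle_mono) auto
    have le2: "(e / 8 * \<tau>\<^sup>2 + e / 8 * \<tau>\<^sup>2) + ((e / 8 + e / 4) * \<tau>\<^sup>2 + e / 8 * \<tau>\<^sup>2) \<le> e * \<tau>\<^sup>2"
      using mult_nonneg_nonneg[of e "\<tau>\<^sup>2"] \<open>e > 0\<close> by (simp add: algebra_simps)
    show "norm (y' - (y0 + t *\<^sub>R (v + \<sigma> *\<^sub>R F y0)
        + t\<^sup>2 *\<^sub>R (w + \<sigma> *\<^sub>R D y0 v + (\<sigma>\<^sup>2 / 2) *\<^sub>R D y0 (F y0)))) \<le> e * \<tau>\<^sup>2"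
      unfolding eq by (rule order_trans[OF le1 le2])
  qed (use \<open>e > 0\<close> in auto)
qed

section \<open>Commutators\<close>

text \<open>The factor \<open>\<sigma>\<close> lets one steering map for \<open>F\<close> serve both
  directions: the loop below uses \<open>1\<close> and \<open>-1\<close>.\<close>

lemma steers_compose:
  fixes F :: "'a::euclidean_space \<Rightarrow> 'a"
  assumes "transp S" and F: "uniformly_C1 (cball c R) F D" and "\<bar>\<sigma>\<bar> \<le> 1"
    and "bounded (v ` cball c R)" "bounded (w ` cball c R)"
    and s1: "steers S c R 2 (\<lambda>t y. y + t *\<^sub>R v y + t\<^sup>2 *\<^sub>R w y)"
    and s2: "steers S c R 2 (\<lambda>t y. y + t *\<^sub>R F y + (t\<^sup>2 / 2) *\<^sub>R D y (F y))"
  shows "steers S c R 2 (\<lambda>t y. y + t *\<^sub>R (v y + \<sigma> *\<^sub>R F y)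
      + t\<^sup>2 *\<^sub>R (w y + \<sigma> *\<^sub>R D y (v y) + (\<sigma>\<^sup>2 / 2) *\<^sub>R D y (F y)))" (is "steers S c R 2 ?\<Phi>")
  unfolding steers_def
proof (intro allI impI)
  fix \<rho> e :: real assume "\<rho> < R" "0 < e"
  define \<rho>' where "\<rho>' = (\<rho> + R) / 2"
  have \<rho>': "\<rho> < \<rho>'" "\<rho>' < R" using \<open>\<rho> < R\<close> by (auto simp: \<rho>'_def)
  obtain C1 C2 where "\<forall>x\<in>v ` cball c R. norm x \<le> C1" "\<forall>x\<in>w ` cball c R. norm x \<le> C2"
    using assms(4,5) unfolding bounded_iff by blast
  then obtain C where "C \<ge> 0" and C: "\<And>y. y \<in> cball c R \<Longrightarrow> norm (v y) \<le> C"
    "\<And>y. y \<in> cball c R \<Longrightarrow> norm (w y) \<le> C"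
    using that[of "max 0 (max C1 C2)"] by (auto simp: le_max_iff_disj)
  obtain e' \<tau>0 where e': "0 < e'" "e' \<le> 1" "\<tau>0 > 0" and step:
    "\<And>\<tau> t y0 y y' v w. 0 < \<tau> \<Longrightarrow> \<tau> \<le> \<tau>0 \<Longrightarrow> \<bar>t\<bar> \<le> \<tau> \<Longrightarrow> y0 \<in> cball c R \<Longrightarrow> y \<in> cball c R \<Longrightarrow>
      norm v \<le> C \<Longrightarrow> norm w \<le> C \<Longrightarrow>
      norm (y - (y0 + t *\<^sub>R v + t\<^sup>2 *\<^sub>R w)) \<le> e' * \<tau>\<^sup>2 \<Longrightarrow>
      norm (y' - (y + (\<sigma> * t) *\<^sub>R F y + ((\<sigma> * t)\<^sup>2 / 2) *\<^sub>R D y (F y))) \<le> e' * \<tau>\<^sup>2 \<Longrightarrow>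
      norm (y' - (y0 + t *\<^sub>R (v + \<sigma> *\<^sub>R F y0) + t\<^sup>2 *\<^sub>R (w + \<sigma> *\<^sub>R D y0 v + (\<sigma>\<^sup>2 / 2) *\<^sub>R D y0 (F y0)))) \<le> e * \<tau>\<^sup>2"
    by (rule second_order_step[OF F \<open>e > 0\<close> \<open>C \<ge> 0\<close> \<open>\<bar>\<sigma>\<bar> \<le> 1\<close>]) blast
  obtain d1 where d1: "d1 > 0" "\<And>d. 0 < d \<Longrightarrow> d \<le> d1 \<Longrightarrow> \<exists>A. steering S (cball c \<rho>) d (e' * d\<^sup>2)
      (\<lambda>t y. y + t *\<^sub>R v y + t\<^sup>2 *\<^sub>R w y) A"
    using steersE[OF s1 \<open>\<rho> < R\<close> e'(1)] by blast
  obtain d2 where d2: "d2 > 0" "\<And>d. 0 < d \<Longrightarrow> d \<le> d2 \<Longrightarrow> \<exists>A. steering S (cball c \<rho>') d (e' * d\<^sup>2)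
      (\<lambda>t y. y + t *\<^sub>R F y + (t\<^sup>2 / 2) *\<^sub>R D y (F y)) A"
    using steersE[OF s2 \<rho>'(2) e'(1)] by blast
  \<comment> \<open>The last entry keeps \<open>A1 t y\<close>, which moves by at most
    \<open>(2 * C + 1) * d\<close>, in the ball where \<open>A2\<close> is available.\<close>
  define d0 where "d0 = Min {1, \<tau>0, d1, d2, (\<rho>' - \<rho>) / (2 * C + 1)}"
  have "d0 > 0" using e' d1(1) d2(1) \<rho>' \<open>C \<ge> 0\<close> by (simp add: d0_def)
  have "\<exists>A. steering S (cball c \<rho>) d (e * d\<^sup>2) ?\<Phi> A" if dd: "0 < d" "d \<le> d0" for d
  proof -
    have d: "d \<le> 1" "d \<le> \<tau>0" "d \<le> d1" "d \<le> d2" "(2 * C + 1) * d \<le> \<rho>' - \<rho>"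
      using dd(2) \<open>C \<ge> 0\<close> by (auto simp: d0_def pos_le_divide_eq mult.commute)
    obtain A1 where A1: "steering S (cball c \<rho>) d (e' * d\<^sup>2) (\<lambda>t y. y + t *\<^sub>R v y + t\<^sup>2 *\<^sub>R w y) A1"
      using d1(2)[OF dd(1) d(3)] by blast
    obtain A2 where A2: "steering S (cball c \<rho>') d (e' * d\<^sup>2) (\<lambda>t y. y + t *\<^sub>R F y + (t\<^sup>2 / 2) *\<^sub>R D y (F y)) A2"
      using d2(2)[OF dd(1) d(4)] by blast
    have A1e: "norm (A1 t y - (y + t *\<^sub>R v y + t\<^sup>2 *\<^sub>R w y)) \<le> e' * d\<^sup>2"
      and A1S: "S y (A1 t y)" if "\<bar>t\<bar> \<le> d" "y \<in> cball c \<rho>" for t y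
      using A1 that by (auto simp: steering_def abs_le_iff)
    have in_R: "y \<in> cball c R" if "y \<in> cball c \<rho>" for y using that \<open>\<rho> < R\<close> by auto
    have A1in: "A1 t y \<in> cball c \<rho>'" if t: "\<bar>t\<bar> \<le> d" and y: "y \<in> cball c \<rho>" for t y
    proof -
      have "t\<^sup>2 \<le> d\<^sup>2" using t \<open>0 < d\<close> by (simp add: abs_le_square_iff[symmetric])
      have "d\<^sup>2 \<le> d" using \<open>0 < d\<close> d(1) by (simp add: power2_eq_square mult_left_le)
      have "norm (t *\<^sub>R v y) \<le> d * C" "norm (t\<^sup>2 *\<^sub>R w y) \<le> d * C"
        using t \<open>t\<^sup>2 \<le> d\<^sup>2\<close> \<open>d\<^sup>2 \<le> d\<close> C[OF in_R[OF y]] \<open>0 < d\<close> by (auto intro!: mult_mono)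
      then have "norm (t *\<^sub>R v y + t\<^sup>2 *\<^sub>R w y) \<le> d * C + d * C" by (rule norm_triangle_mono)
      moreover have "norm (A1 t y - (y + t *\<^sub>R v y + t\<^sup>2 *\<^sub>R w y)) \<le> d"
        using A1e[OF t y] mult_right_mono[OF e'(2), of "d\<^sup>2"] \<open>d\<^sup>2 \<le> d\<close> by simp
      ultimately have "norm ((t *\<^sub>R v y + t\<^sup>2 *\<^sub>R w y) + (A1 t y - (y + t *\<^sub>R v y + t\<^sup>2 *\<^sub>R w y)))
          \<le> (d * C + d * C) + d"
        by (rule norm_triangle_mono)
      then have "norm (A1 t y - y) \<le> (2 * C + 1) * d" by (simp add: algebra_simps)
      then have "norm (A1 t y - y) \<le> \<rho>' - \<rho>" using d(5) by linarith
      then show ?thesis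
        using y norm_triangle_ineq[of "A1 t y - y" "y - c"] by (simp add: dist_norm norm_minus_commute)
    qed
    have \<sigma>t: "\<bar>\<sigma> * t\<bar> \<le> d" if "\<bar>t\<bar> \<le> d" for t
      using mult_mono[OF \<open>\<bar>\<sigma>\<bar> \<le> 1\<close> that] by (simp add: abs_mult)
    have A2e: "norm (A2 (\<sigma> * t) z - (z + (\<sigma> * t) *\<^sub>R F z + ((\<sigma> * t)\<^sup>2 / 2) *\<^sub>R D z (F z))) \<le> e' * d\<^sup>2"
      and A2S: "S z (A2 (\<sigma> * t) z)" if "\<bar>t\<bar> \<le> d" "z \<in> cball c \<rho>'" for t z
      using A2 \<sigma>t[OF that(1)] that(2) by (auto simp: steering_def abs_le_iff)
    have "steering S (cball c \<rho>) d (e * d\<^sup>2) ?\<Phi> (\<lambda>t y. A2 (\<sigma> * t) (A1 t y))"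
      unfolding steering_def
    proof (intro conjI ballI)
      have "continuous_on ({-d..d} \<times> cball c \<rho>) (\<lambda>p. A2 (\<sigma> * fst p) (A1 (fst p) (snd p)))"
        by (rule continuous_on_steering[OF A2 _ continuous_on_steering[OF A1]])
          (auto intro!: continuous_intros A1in[unfolded mem_cball] \<sigma>t)
      then show "continuous_on ({-d..d} \<times> cball c \<rho>) (\<lambda>(t, y). A2 (\<sigma> * t) (A1 t y))"
        by (simp add: split_beta)
    next
      fix y assume "y \<in> cball c \<rho>"
      then show "A2 (\<sigma> * 0) (A1 0 y) = y" using A1 A2 \<rho>' by (auto simp: steering_def)
    next
      fix t y assume "t \<in> {-d..d}" and y: "y \<in> cball c \<rho>"
      then have t: "\<bar>t\<bar> \<le> d" by auto
      show "S y (A2 (\<sigma> * t) (A1 t y))"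
        using A1S[OF t y] A2S[OF t A1in[OF t y]] \<open>transp S\<close> by (rule transpD[rotated])
      have "A1 t y \<in> cball c R" using A1in[OF t y] \<rho>' by auto
      from step[OF dd(1) d(2) t in_R[OF y] this C[OF in_R[OF y]] A1e[OF t y] A2e[OF t A1in[OF t y]]]
      show "norm (A2 (\<sigma> * t) (A1 t y) - ?\<Phi> t y) \<le> e * d\<^sup>2" .
    qed
    then show ?thesis by blast
  qed
  then show "\<exists>d0>0. \<forall>d. 0 < d \<and> d \<le> d0 \<longrightarrow> (\<exists>A. steering S (cball c \<rho>) d (e * d\<^sup>2) ?\<Phi> A)"
    using \<open>d0 > 0\<close> by blast
qed

text \<open>The linear terms \<open>X + Y - X - Y\<close> cancel. Among the quadratic ones, the four
  halves add up to \<open>D X + E Y\<close>, the second side contributes \<open>E X\<close>, the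
  third \<open>-D (X + Y)\<close> and the fourth \<open>-E Y\<close>, since the linear part is just
  \<open>Y\<close> by then; what remains is \<open>E X - D Y\<close>. Second derivatives never
  occur, so \<open>C^1\<close> fields suffice.\<close>

lemma steers_commutator_loop:
  fixes X Y :: "'a::euclidean_space \<Rightarrow> 'a"
  assumes "transp S" and X: "uniformly_C1 (cball c R) X D" and Y: "uniformly_C1 (cball c R) Y E"
    and sX: "steers S c R 2 (\<lambda>t y. y + t *\<^sub>R X y + (t\<^sup>2 / 2) *\<^sub>R D y (X y))"
    and sY: "steers S c R 2 (\<lambda>t y. y + t *\<^sub>R Y y + (t\<^sup>2 / 2) *\<^sub>R E y (Y y))"
  shows "steers S c R 2 (\<lambda>t y. y + t\<^sup>2 *\<^sub>R (E y (X y) - D y (Y y)))"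
proof -
  obtain M where M: "\<And>y. y \<in> cball c R \<Longrightarrow> norm (X y) \<le> M" "\<And>y. y \<in> cball c R \<Longrightarrow> linear (D y)"
    "\<And>y v. y \<in> cball c R \<Longrightarrow> norm (D y v) \<le> M * norm v" "M \<ge> 1"
    using uniformly_C1_bounds[OF X] by metis
  obtain N where N: "\<And>y. y \<in> cball c R \<Longrightarrow> norm (Y y) \<le> N" "\<And>y. y \<in> cball c R \<Longrightarrow> linear (E y)"
    "\<And>y v. y \<in> cball c R \<Longrightarrow> norm (E y v) \<le> N * norm v" "N \<ge> 1"
    using uniformly_C1_bounds[OF Y] by metis
  have bd_field: "bounded (X ` cball c R)" "bounded (Y ` cball c R)"
    using M(1) N(1) unfolding bounded_iff by blast+
  have bd_apply: "bounded ((\<lambda>y. A y (f y)) ` cball c R)"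
    if f: "bounded (f ` cball c R)" and A: "\<And>y v. y \<in> cball c R \<Longrightarrow> norm (A y v) \<le> K * norm v" and "K \<ge> 1"
    for A :: "'a \<Rightarrow> 'a \<Rightarrow> 'a" and f K
  proof -
    obtain C where "\<forall>x\<in>f ` cball c R. norm x \<le> C" using f unfolding bounded_iff by blast
    then have "norm (A y (f y)) \<le> K * C" if "y \<in> cball c R" for y
      using order_trans[OF A[OF that, of "f y"] mult_left_mono[of "norm (f y)" C K]] that \<open>K \<ge> 1\<close> by auto
    then show ?thesis unfolding bounded_iff by blast
  qed
  note bd = bounded_plus_comp bounded_scaleR_comp bd_field bd_apply[OF _ M(3) M(4)] bd_apply[OF _ N(3) N(4)]
  have s1: "steers S c R 2 (\<lambda>t y. y + t *\<^sub>R X y + t\<^sup>2 *\<^sub>R (1/2) *\<^sub>R D y (X y))"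
    using sX by simp
  have s2: "steers S c R 2 (\<lambda>t y. y + t *\<^sub>R (X y + 1 *\<^sub>R Y y) +
      t\<^sup>2 *\<^sub>R ((1/2) *\<^sub>R D y (X y) + 1 *\<^sub>R E y (X y) + (1\<^sup>2 / 2) *\<^sub>R E y (Y y)))"
    by (rule steers_compose[OF assms(1) Y _ _ _ s1 sY]) (intro bd | simp)+
  have s3: "steers S c R 2 (\<lambda>t y. y + t *\<^sub>R ((X y + 1 *\<^sub>R Y y) + (-1) *\<^sub>R X y) +
      t\<^sup>2 *\<^sub>R (((1/2) *\<^sub>R D y (X y) + 1 *\<^sub>R E y (X y) + (1\<^sup>2 / 2) *\<^sub>R E y (Y y))
        + (-1) *\<^sub>R D y (X y + 1 *\<^sub>R Y y) + ((-1)\<^sup>2 / 2) *\<^sub>R D y (X y)))"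
    by (rule steers_compose[OF assms(1) X _ _ _ s2 sX]) (intro bd | simp)+
  have "steers S c R 2 (\<lambda>t y. y + t *\<^sub>R (((X y + 1 *\<^sub>R Y y) + (-1) *\<^sub>R X y) + (-1) *\<^sub>R Y y) +
      t\<^sup>2 *\<^sub>R ((((1/2) *\<^sub>R D y (X y) + 1 *\<^sub>R E y (X y) + (1\<^sup>2 / 2) *\<^sub>R E y (Y y))
        + (-1) *\<^sub>R D y (X y + 1 *\<^sub>R Y y) + ((-1)\<^sup>2 / 2) *\<^sub>R D y (X y))
        + (-1) *\<^sub>R E y ((X y + 1 *\<^sub>R Y y) + (-1) *\<^sub>R X y) + ((-1)\<^sup>2 / 2) *\<^sub>R E y (Y y)))"
    by (rule steers_compose[OF assms(1) Y _ _ _ s3 sY]) (intro bd | simp)+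
  then show ?thesis
  proof (rule steers_cong)
    fix t y assume y: "y \<in> cball c R"
    interpret D: linear "D y" by (rule M(2)[OF y])
    have half: "(1/2) *\<^sub>R a + (1/2) *\<^sub>R a = a" for a :: 'a
      by (simp add: scaleR_add_left[symmetric])
    have "((1/2) *\<^sub>R D y (X y) + 1 *\<^sub>R E y (X y) + (1\<^sup>2 / 2) *\<^sub>R E y (Y y))
        + (-1) *\<^sub>R D y (X y + 1 *\<^sub>R Y y) + ((-1)\<^sup>2 / 2) *\<^sub>R D y (X y)
        + (-1) *\<^sub>R E y ((X y + 1 *\<^sub>R Y y) + (-1) *\<^sub>R X y) + ((-1)\<^sup>2 / 2) *\<^sub>R E y (Y y)
      = ((1/2) *\<^sub>R D y (X y) + (1/2) *\<^sub>R D y (X y)) + ((1/2) *\<^sub>R E y (Y y) + (1/2) *\<^sub>R E y (Y y))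
        + E y (X y) - D y (X y) - D y (Y y) - E y (Y y)"
      by (simp add: D.add algebra_simps)
    also have "\<dots> = E y (X y) - D y (Y y)" unfolding half by simp
    finally show "y + t *\<^sub>R (((X y + 1 *\<^sub>R Y y) + (-1) *\<^sub>R X y) + (-1) *\<^sub>R Y y) +
      t\<^sup>2 *\<^sub>R ((((1/2) *\<^sub>R D y (X y) + 1 *\<^sub>R E y (X y) + (1\<^sup>2 / 2) *\<^sub>R E y (Y y))
        + (-1) *\<^sub>R D y (X y + 1 *\<^sub>R Y y) + ((-1)\<^sup>2 / 2) *\<^sub>R D y (X y))
        + (-1) *\<^sub>R E y ((X y + 1 *\<^sub>R Y y) + (-1) *\<^sub>R X y) + ((-1)\<^sup>2 / 2) *\<^sub>R E y (Y y))
      = y + t\<^sup>2 *\<^sub>R (E y (X y) - D y (Y y))"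
      by (simp only:) simp
  qed
qed

section \<open>From loops to first order steering of the bracket\<close>

lemma continuous_on_glue_at_0:
  assumes "continuous_on ({0..d} \<times> K) (\<lambda>p. f (fst p) (snd p))" "continuous_on ({0..d} \<times> K) (\<lambda>p. g (fst p) (snd p))"
    "\<And>y. y \<in> K \<Longrightarrow> f 0 y = g 0 y"
  shows "continuous_on ({-d..d::real} \<times> K) (\<lambda>(h, y). if h \<le> 0 then g (- h) y else f h y)"
proof -
  have "continuous_on ({-d..d} \<times> K) (\<lambda>p. if fst p \<le> 0 then g (- fst p) (snd p) else f (fst p) (snd p))"
  proof (rule continuous_on_cases_le)
    show "continuous_on {p \<in> {-d..d} \<times> K. fst p \<le> 0} (\<lambda>p. g (- fst p) (snd p))"
      using continuous_on_compose2[OF assms(2), of "{p \<in> {-d..d} \<times> K. fst p \<le> 0}" "\<lambda>p. (- fst p, snd p)"]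
      by (force intro!: continuous_intros)
    show "continuous_on {p \<in> {-d..d} \<times> K. 0 \<le> fst p} (\<lambda>p. f (fst p) (snd p))"
      by (rule continuous_on_subset[OF assms(1)]) auto
  qed (use assms(3) in \<open>auto intro!: continuous_intros\<close>)
  then show ?thesis by (simp add: split_beta)
qed

text \<open>With \<open>t = sqrt h\<close> the error \<open>e * (sqrt d)\<^sup>2\<close> is exactly
  the \<open>e * d\<close> demanded at first order. As \<open>t\<^sup>2\<close> cannot be negative,
  negative \<open>h\<close> needs a second loop, for \<open>- W\<close>. The square root is not
  differentiable at \<open>0\<close>, but only continuity is asked of the steering map.\<close>

lemma steers_sqrt:
  fixes W :: "'a::euclidean_space \<Rightarrow> 'a"
  assumes s1: "steers S c R 2 (\<lambda>t y. y + t\<^sup>2 *\<^sub>R W y)" and s2: "steers S c R 2 (\<lambda>t y. y + t\<^sup>2 *\<^sub>R (- W y))"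
  shows "steers S c R 1 (\<lambda>h y. y + h *\<^sub>R W y)"
  unfolding steers_def
proof (intro allI impI)
  fix \<rho> e :: real assume *: "\<rho> < R" "0 < e"
  obtain d1 where d1: "d1 > 0" "\<And>d. 0 < d \<Longrightarrow> d \<le> d1 \<Longrightarrow>
      \<exists>A. steering S (cball c \<rho>) d (e * d\<^sup>2) (\<lambda>t y. y + t\<^sup>2 *\<^sub>R W y) A"
    using steersE[OF s1 *] by blast
  obtain d2 where d2: "d2 > 0" "\<And>d. 0 < d \<Longrightarrow> d \<le> d2 \<Longrightarrow>
      \<exists>A. steering S (cball c \<rho>) d (e * d\<^sup>2) (\<lambda>t y. y + t\<^sup>2 *\<^sub>R (- W y)) A"
    using steersE[OF s2 *] by blast
  have "\<exists>A. steering S (cball c \<rho>) d (e * d^1) (\<lambda>h y. y + h *\<^sub>R W y) A"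
    if d: "0 < d" "d \<le> (min d1 d2)\<^sup>2" for d
  proof -
    have "sqrt d \<le> min d1 d2" using d d1(1) d2(1) by (intro real_le_lsqrt) auto
    then obtain A1 A2 where A1: "steering S (cball c \<rho>) (sqrt d) (e * d) (\<lambda>t y. y + t\<^sup>2 *\<^sub>R W y) A1"
      and A2: "steering S (cball c \<rho>) (sqrt d) (e * d) (\<lambda>t y. y + t\<^sup>2 *\<^sub>R (- W y)) A2"
      using d1(2)[of "sqrt d"] d2(2)[of "sqrt d"] d(1) by auto
    have sqrt: "\<bar>sqrt h\<bar> \<le> sqrt d" if "0 \<le> h" "h \<le> d" for h using that by simp
    have cont: "continuous_on ({0..d} \<times> cball c \<rho>) (\<lambda>p. A (sqrt (fst p)) (snd p))"
      if "steering S (cball c \<rho>) (sqrt d) (e * d) \<Phi> A" for \<Phi> A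
      by (rule continuous_on_steering[OF that]) (auto intro!: continuous_intros)
    define A where "A h y = (if h \<le> 0 then A2 (sqrt (- h)) y else A1 (sqrt h) y)" for h y
    have est: "S y (A h y) \<and> norm (A h y - (y + h *\<^sub>R W y)) \<le> e * d"
      if h: "h \<in> {-d..d}" and y: "y \<in> cball c \<rho>" for h y
    proof (cases "h \<le> 0")
      case True
      then have "\<bar>sqrt (- h)\<bar> \<le> sqrt d" using h by (intro sqrt) auto
      then have "S y (A2 (sqrt (- h)) y)" "norm (A2 (sqrt (- h)) y - (y + (sqrt (- h))\<^sup>2 *\<^sub>R (- W y))) \<le> e * d"
        using A2 y unfolding steering_def abs_le_iff by auto
      then show ?thesis using True by (simp add: A_def)
    next
      case False
      then have "\<bar>sqrt h\<bar> \<le> sqrt d" using h by (intro sqrt) auto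
      then have "S y (A1 (sqrt h) y)" "norm (A1 (sqrt h) y - (y + (sqrt h)\<^sup>2 *\<^sub>R W y)) \<le> e * d"
        using A1 y unfolding steering_def abs_le_iff by auto
      then show ?thesis using False by (simp add: A_def)
    qed
    have "steering S (cball c \<rho>) d (e * d^1) (\<lambda>h y. y + h *\<^sub>R W y) A"
      unfolding steering_def
    proof (intro conjI ballI)
      show "continuous_on ({-d..d} \<times> cball c \<rho>) (\<lambda>(h, y). A h y)"
        unfolding A_def using A1 A2
        by (intro continuous_on_glue_at_0[of d _ "\<lambda>h. A1 (sqrt h)" "\<lambda>h. A2 (sqrt h)"] cont)
          (auto simp: steering_def)
      show "A 0 y = y" if "y \<in> cball c \<rho>" for y using that A2 by (simp add: A_def steering_def)
    qed (use est in auto)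
    then show ?thesis by blast
  qed
  moreover have "(min d1 d2)\<^sup>2 > 0" using d1(1) d2(1) by (simp add: min_def)
  ultimately show "\<exists>d0>0. \<forall>d. 0 < d \<and> d \<le> d0 \<longrightarrow>
      (\<exists>A. steering S (cball c \<rho>) d (e * d^1) (\<lambda>h y. y + h *\<^sub>R W y) A)"
    by blast
qed

text \<open>The loop in the opposite order, with \<open>X\<close> and \<open>Y\<close> exchanged,
  supplies the sign change. Only pointwise values of the commutator enter, so it may be merely
  continuous.\<close>

lemma steers_commutator:
  fixes X Y :: "'a::euclidean_space \<Rightarrow> 'a"
  assumes S: "reflp S" "transp S" and X: "uniformly_C1 (cball c R) X D" and Y: "uniformly_C1 (cball c R) Y E"
    and sX: "steers S c R 1 (\<lambda>h y. y + h *\<^sub>R X y)" and sY: "steers S c R 1 (\<lambda>h y. y + h *\<^sub>R Y y)"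
  shows "steers S c R 1 (\<lambda>h y. y + h *\<^sub>R (E y (X y) - D y (Y y)))"
proof -
  note X2 = steers_second_order[OF S X sX] and Y2 = steers_second_order[OF S Y sY]
  from steers_commutator_loop[OF S(2) Y X Y2 X2]
  have "steers S c R 2 (\<lambda>t y. y + t\<^sup>2 *\<^sub>R (- (E y (X y) - D y (Y y))))" by simp
  from steers_sqrt[OF steers_commutator_loop[OF S(2) X Y X2 Y2] this] show ?thesis .
qed

section \<open>Steering along flows and reachable neighbourhoods\<close>

lemma norm_increment_le:
  fixes f :: "real \<Rightarrow> 'a::real_normed_vector"
  assumes "\<And>s. s \<in> {0..t} \<Longrightarrow> (f has_vector_derivative f' s) (at s within {0..t})"
    and "\<And>s. s \<in> {0..t} \<Longrightarrow> norm (f' s) \<le> B" and "0 \<le> t"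
  shows "norm (f t - f 0) \<le> B * t"
proof -
  have "norm (f t - f 0) \<le> B * norm (t - 0)"
  proof (rule differentiable_bound[of "{0..t}" f "\<lambda>s h. h *\<^sub>R f' s"])
    show "onorm (\<lambda>h. h *\<^sub>R f' s) \<le> B" if "s \<in> {0..t}" for s
    proof (rule onorm_le)
      show "norm (h *\<^sub>R f' s) \<le> B * norm h" for h
        using mult_left_mono[OF assms(2)[OF that], of "\<bar>h\<bar>"] by (simp add: mult.commute)
    qed
  qed (use assms in \<open>auto simp: has_vector_derivative_def\<close>)
  then show ?thesis using \<open>0 \<le> t\<close> by simp
qed

lemma uniformly_C1_uminus:
  assumes "uniformly_C1 B F D"
  shows "uniformly_C1 B (\<lambda>y. - F y) (\<lambda>y v. - D y v)"
proof -
  obtain M where M: "\<And>y. y \<in> B \<Longrightarrow> norm (F y) \<le> M" "\<And>y. y \<in> B \<Longrightarrow> linear (D y)"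
    "\<And>y v. y \<in> B \<Longrightarrow> norm (D y v) \<le> M * norm v"
    "\<And>y z. y \<in> B \<Longrightarrow> z \<in> B \<Longrightarrow> norm (F z - F y) \<le> M * norm (z - y)"
    using uniformly_C1_bounds[OF assms] by metis
  have sgn: "norm (- F z - - F y) = norm (F z - F y)"
    "norm (- F z - - F y - - D y (z - y)) = norm (F z - F y - D y (z - y))" for y z
    using norm_minus_cancel[of "F z - F y"] norm_minus_cancel[of "F z - F y - D y (z - y)"]
    by (simp_all add: algebra_simps)
  show ?thesis
    unfolding uniformly_C1_def sgn
  proof (intro conjI allI impI)
    show "\<exists>M. \<forall>y\<in>B. norm (- F y) \<le> M \<and> linear (\<lambda>v. - D y v) \<and>
        (\<forall>v. norm (- D y v) \<le> M * norm v) \<and> (\<forall>z\<in>B. norm (F z - F y) \<le> M * norm (z - y))"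
      using M by (intro exI[of _ M]) (auto intro: linear_compose_neg)
    fix e :: real assume "e > 0"
    from uniformly_C1_modulus[OF assms this] obtain d where d: "d > 0"
      "\<And>y z. y \<in> B \<Longrightarrow> z \<in> B \<Longrightarrow> norm (z - y) \<le> d \<Longrightarrow> norm (F z - F y - D y (z - y)) \<le> e * norm (z - y)"
      "\<And>y z. y \<in> B \<Longrightarrow> z \<in> B \<Longrightarrow> norm (z - y) \<le> d \<Longrightarrow> norm (D z (F z) - D y (F y)) \<le> e" by metis
    show "\<exists>d>0. \<forall>y\<in>B. \<forall>z\<in>B. norm (z - y) \<le> d \<longrightarrow>
        norm (F z - F y - D y (z - y)) \<le> e * norm (z - y) \<and> norm (- D z (- F z) - - D y (- F y)) \<le> e"
      using d M(2) by (intro exI[of _ d]) (auto simp: linear_neg)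
  qed
qed

text \<open>The field is controlled only on a ball. Composing it with the nearest point projection,
  which is 1-Lipschitz, gives a bounded and globally Lipschitz field; its curves are curves of
  \<open>F\<close> as long as they stay in the ball.\<close>

lemma local_flow:
  fixes F :: "'a::euclidean_space \<Rightarrow> 'a"
  assumes F: "uniformly_C1 (cball c R) F D" and "R > 0" "\<rho> < R"
  obtains T \<phi> M where "T > 0" "M \<ge> 0" "continuous_on UNIV (\<lambda>(t, y). \<phi> t y)" "\<And>y. \<phi> 0 y = y"
    "\<And>t y. t \<in> {0..T} \<Longrightarrow> y \<in> cball c \<rho> \<Longrightarrow> \<phi> t y \<in> cball c R"
    "\<And>t y. t \<in> {0..T} \<Longrightarrow> y \<in> cball c \<rho> \<Longrightarrow>
       ((\<lambda>t. \<phi> t y) has_vector_derivative F (\<phi> t y)) (at t within {0..T})"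
    "\<And>t y. t \<in> {0..T} \<Longrightarrow> y \<in> cball c \<rho> \<Longrightarrow> norm (\<phi> t y - (y + t *\<^sub>R F y)) \<le> M * t\<^sup>2"
proof -
  obtain M where "M \<ge> 1" and M: "\<And>y. y \<in> cball c R \<Longrightarrow> norm (F y) \<le> M"
    "\<And>y z. y \<in> cball c R \<Longrightarrow> z \<in> cball c R \<Longrightarrow> norm (F z - F y) \<le> M * norm (z - y)"
    using uniformly_C1_bounds[OF F] by metis
  define P where "P = closest_point (cball c R)"
  have P: "P x \<in> cball c R" "norm (P x - P y) \<le> norm (x - y)" for x y
    using closest_point_in_set[of "cball c R"] closest_point_lipschitz[of "cball c R" x y] \<open>R > 0\<close>
    by (simp_all add: P_def dist_norm)
  have PR: "P x = x" if "x \<in> cball c R" for x using that by (simp add: P_def closest_point_self)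
  have lip: "norm (F (P x) - F (P y)) \<le> M * norm (x - y)" for x y
    using order_trans[OF M(2)[OF P(1) P(1)] mult_left_mono[OF P(2)]] \<open>M \<ge> 1\<close> by simp
  obtain T0 \<phi> where "T0 > 0" and \<phi>: "continuous_on UNIV (\<lambda>(t, y). \<phi> t y)" "\<And>y. \<phi> 0 y = y"
    "\<And>t y. t \<in> {0..T0} \<Longrightarrow> ((\<lambda>t. \<phi> t y) has_vector_derivative F (P (\<phi> t y))) (at t within {0..T0})"
    using lipschitz_flow[of "\<lambda>x. F (P x)", OF lip M(1)[OF P(1)]] by metis
  \<comment> \<open>At speed at most \<open>M\<close>, a curve from \<open>cball c \<rho>\<close>
    needs at least this time to leave \<open>cball c R\<close>.\<close>
  define T where "T = min T0 ((R - \<rho>) / M)"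
  have "T > 0" using \<open>T0 > 0\<close> assms \<open>M \<ge> 1\<close> by (simp add: T_def)
  have deriv: "((\<lambda>t. \<phi> t y) has_vector_derivative F (P (\<phi> s y))) (at s within {0..t})"
    if "t \<in> {0..T}" "s \<in> {0..t}" for s t y
    by (rule has_vector_derivative_within_subset[OF \<phi>(3)]) (use that in \<open>auto simp: T_def\<close>)
  have move: "norm (\<phi> t y - y) \<le> M * t" if "t \<in> {0..T}" for t y
    using norm_increment_le[of t "\<lambda>t. \<phi> t y", OF deriv[OF that] M(1)[OF P(1)]] that \<phi>(2) by auto
  have stay: "\<phi> t y \<in> cball c R" if "t \<in> {0..T}" "y \<in> cball c \<rho>" for t y
  proof -
    have "t \<le> (R - \<rho>) / M" using that(1) by (auto simp: T_def)
    then have "M * t \<le> R - \<rho>" using \<open>M \<ge> 1\<close> by (simp add: pos_le_divide_eq mult.commute)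
    then show ?thesis using move[OF that(1), of y] that(2) norm_triangle_ineq[of "\<phi> t y - y" "y - c"]
      by (simp add: dist_norm norm_minus_commute)
  qed
  show ?thesis
  proof (rule that[of T "M * M" \<phi>])
    fix t y assume t: "t \<in> {0..T}" and y: "y \<in> cball c \<rho>"
    show "\<phi> t y \<in> cball c R" by (rule stay[OF t y])
    then show "((\<lambda>t. \<phi> t y) has_vector_derivative F (\<phi> t y)) (at t within {0..T})"
      using deriv[of T t y] t by (simp add: PR)
    have yR: "y \<in> cball c R" using y \<open>\<rho> < R\<close> by auto
    \<comment> \<open>The difference has derivative \<open>F (\<phi> s y) - F y\<close>, at most
      \<open>M * (M * t)\<close> because the point has moved by at most \<open>M * s\<close>. This
      is where the constant \<open>M * M\<close> comes from.\<close>
    have "norm ((\<phi> t y - t *\<^sub>R F y) - (\<phi> 0 y - 0 *\<^sub>R F y)) \<le> (M * (M * t)) * t"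
    proof (rule norm_increment_le)
      fix s assume s: "s \<in> {0..t}"
      then have sT: "s \<in> {0..T}" using t by auto
      show "((\<lambda>t. \<phi> t y - t *\<^sub>R F y) has_vector_derivative F (P (\<phi> s y)) - F y) (at s within {0..t})"
        using deriv[OF t s, of y] by (auto intro!: derivative_eq_intros)
      have "norm (F (\<phi> s y) - F y) \<le> M * (M * s)"
        using order_trans[OF M(2)[OF yR stay[OF sT y]] mult_left_mono[OF move[OF sT, of y]]] \<open>M \<ge> 1\<close> by simp
      also have "\<dots> \<le> M * (M * t)" using s \<open>M \<ge> 1\<close> by (intro mult_left_mono) auto
      finally show "norm (F (P (\<phi> s y)) - F y) \<le> M * (M * t)" by (simp add: PR[OF stay[OF sT y]])
    qed (use t in auto)
    then show "norm (\<phi> t y - (y + t *\<^sub>R F y)) \<le> M * M * t\<^sup>2"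
      by (simp add: \<phi>(2) power2_eq_square algebra_simps)
  qed (use \<open>T > 0\<close> \<open>M \<ge> 1\<close> \<phi> in auto)
qed

text \<open>The start of the induction over multiindices. Here steering is by a genuine flow with
  error \<open>O(t^2)\<close>; negative parameters follow the flow of \<open>- F\<close>, which is a
  backward arc.\<close>

lemma steers_flow:
  fixes F :: "'a::euclidean_space \<Rightarrow> 'a"
  assumes F: "uniformly_C1 (cball c R) F D" and "R > 0"
    and S: "\<And>G \<phi> T. G = F \<or> G = (\<lambda>y. - F y) \<Longrightarrow> 0 \<le> T \<Longrightarrow> \<phi> ` {0..T} \<subseteq> cball c R \<Longrightarrow>
      (\<And>t. t \<in> {0..T} \<Longrightarrow> (\<phi> has_vector_derivative G (\<phi> t)) (at t within {0..T})) \<Longrightarrow> S (\<phi> 0) (\<phi> T)"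
  shows "steers S c R 1 (\<lambda>h y. y + h *\<^sub>R F y)"
  unfolding steers_def
proof (intro allI impI)
  fix \<rho> e :: real assume "\<rho> < R" "0 < e"
  have *: "\<exists>T M \<phi>. 0 < T \<and> 0 \<le> M \<and> continuous_on UNIV (\<lambda>(t, y). \<phi> t y) \<and> (\<forall>y. \<phi> 0 y = y) \<and>
      (\<forall>t\<in>{0..T}. \<forall>y\<in>cball c \<rho>. S y (\<phi> t y) \<and> norm (\<phi> t y - (y + t *\<^sub>R G y)) \<le> M * t\<^sup>2)"
    if G: "uniformly_C1 (cball c R) G D'" "G = F \<or> G = (\<lambda>y. - F y)" for G D'
  proof -
    obtain T \<phi> M where \<phi>: "T > 0" "M \<ge> 0" "continuous_on UNIV (\<lambda>(t, y). \<phi> t y)" "\<And>y. \<phi> 0 y = y"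
      "\<And>t y. t \<in> {0..T} \<Longrightarrow> y \<in> cball c \<rho> \<Longrightarrow> \<phi> t y \<in> cball c R"
      "\<And>t y. t \<in> {0..T} \<Longrightarrow> y \<in> cball c \<rho> \<Longrightarrow>
         ((\<lambda>t. \<phi> t y) has_vector_derivative G (\<phi> t y)) (at t within {0..T})"
      "\<And>t y. t \<in> {0..T} \<Longrightarrow> y \<in> cball c \<rho> \<Longrightarrow> norm (\<phi> t y - (y + t *\<^sub>R G y)) \<le> M * t\<^sup>2"
      by (rule local_flow[OF G(1) \<open>R > 0\<close> \<open>\<rho> < R\<close>]) blast
    have "S y (\<phi> t y)" if t: "t \<in> {0..T}" and y: "y \<in> cball c \<rho>" for t y
    proof -
      have "S (\<phi> 0 y) (\<phi> t y)"
      proof (rule S[OF G(2), of t "\<lambda>t. \<phi> t y"])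
        show "((\<lambda>t. \<phi> t y) has_vector_derivative G (\<phi> s y)) (at s within {0..t})" if "s \<in> {0..t}" for s
          by (rule has_vector_derivative_within_subset[OF \<phi>(6)[OF _ y]]) (use that t in auto)
      qed (use t \<phi>(5)[OF _ y] in auto)
      then show ?thesis by (simp add: \<phi>(4))
    qed
    then show ?thesis using \<phi> by blast
  qed
  obtain T1 M1 f where f: "0 < T1" "0 \<le> M1" "continuous_on UNIV (\<lambda>(t, y). f t y)" "\<And>y. f 0 y = y"
    "\<And>t y. t \<in> {0..T1} \<Longrightarrow> y \<in> cball c \<rho> \<Longrightarrow> S y (f t y) \<and> norm (f t y - (y + t *\<^sub>R F y)) \<le> M1 * t\<^sup>2"
    using *[OF F] by blast
  obtain T2 M2 g where g: "0 < T2" "0 \<le> M2" "continuous_on UNIV (\<lambda>(t, y). g t y)" "\<And>y. g 0 y = y"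
    "\<And>t y. t \<in> {0..T2} \<Longrightarrow> y \<in> cball c \<rho> \<Longrightarrow> S y (g t y) \<and> norm (g t y - (y + t *\<^sub>R (- F y))) \<le> M2 * t\<^sup>2"
    using *[OF uniformly_C1_uminus[OF F]] by blast
  define M where "M = max M1 M2"
  define d0 where "d0 = Min {T1, T2, e / (M + 1)}"
  have "M \<ge> 0" using f(2) by (simp add: M_def)
  then have "d0 > 0" using f(1) g(1) \<open>0 < e\<close> by (simp add: d0_def)
  have "\<exists>A. steering S (cball c \<rho>) d (e * d^1) (\<lambda>h y. y + h *\<^sub>R F y) A" if d: "0 < d" "d \<le> d0" for d
  proof -
    have d0: "d \<le> T1" "d \<le> T2" using d(2) by (auto simp: d0_def)
    have "M * d \<le> e"
    proof -
      have "(M + 1) * d \<le> e" using d(2) \<open>M \<ge> 0\<close> by (simp add: d0_def pos_le_divide_eq mult.commute)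
      then show ?thesis using d(1) by (simp add: algebra_simps)
    qed
    have err: "K * t\<^sup>2 \<le> e * d" if "0 \<le> K" "K \<le> M" "0 \<le> t" "t \<le> d" for K t
    proof -
      have "K * t\<^sup>2 \<le> M * (d * d)"
        unfolding power2_eq_square using that by (intro mult_mono) auto
      also have "\<dots> \<le> e * d" using \<open>M * d \<le> e\<close> d(1) by (simp add: mult.assoc[symmetric] mult_right_mono)
      finally show ?thesis .
    qed
    define A where "A h y = (if h \<le> 0 then g (- h) y else f h y)" for h y
    have "S y (A h y) \<and> norm (A h y - (y + h *\<^sub>R F y)) \<le> e * d"
      if h: "h \<in> {-d..d}" and y: "y \<in> cball c \<rho>" for h y
    proof (cases "h \<le> 0")
      case True
      then have "- h \<in> {0..T2}" using h d0 by auto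
      from g(5)[OF this y] err[of M2 "- h"] True g(2) h show ?thesis by (auto simp: A_def M_def)
    next
      case False
      then have "h \<in> {0..T1}" using h d0 by auto
      from f(5)[OF this y] err[of M1 h] False f(2) h show ?thesis by (auto simp: A_def M_def)
    qed
    moreover have "continuous_on ({-d..d} \<times> cball c \<rho>) (\<lambda>(h, y). A h y)"
      unfolding A_def using f(3,4) g(3,4)
      by (intro continuous_on_glue_at_0) (auto simp: split_beta intro: continuous_on_subset)
    ultimately have "steering S (cball c \<rho>) d (e * d^1) (\<lambda>h y. y + h *\<^sub>R F y) A"
      by (simp add: steering_def A_def g(4))
    then show ?thesis by blast
  qed
  then show "\<exists>d0>0. \<forall>d. 0 < d \<and> d \<le> d0 \<longrightarrow>
      (\<exists>A. steering S (cball c \<rho>) d (e * d^1) (\<lambda>h y. y + h *\<^sub>R F y) A)"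
    using \<open>d0 > 0\<close> by blast
qed

text \<open>The coordinates \<open>h \<bullet> b\<close> serve as steering parameters, so the
  parameter space is a ball in the space itself, as Brouwer's theorem wants. Each further field
  starts at \<open>G h\<close> instead of \<open>c\<close>; continuity of that field at
  \<open>c\<close> absorbs the difference. Three errors of \<open>e / 4 * d\<close> arise: from the
  new move, from this change of base point, and from the induction hypothesis.\<close>

lemma steers_simultaneously:
  fixes Z :: "'a::euclidean_space \<Rightarrow> 'a \<Rightarrow> 'a"
  assumes S: "reflp S" "transp S" and "R > 0" and "finite I" "I \<subseteq> Basis"
    and "\<And>b. b \<in> I \<Longrightarrow> steers S c R 1 (\<lambda>h y. y + h *\<^sub>R Z b y)"
    and "\<And>b. b \<in> I \<Longrightarrow> continuous (at c) (Z b)"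
    and "e > 0"
  shows "\<exists>d0>0. \<forall>d. 0 < d \<and> d \<le> d0 \<longrightarrow> (\<exists>G. continuous_on (cball 0 d) G \<and>
      (\<forall>h\<in>cball 0 d. S c (G h) \<and> norm (G h - (c + (\<Sum>b\<in>I. (h \<bullet> b) *\<^sub>R Z b c))) \<le> e * d))"
  using assms(4-8)
proof (induction I arbitrary: e rule: finite_induct)
  case empty
  then show ?case using S(1)
    by (intro exI[of _ 1] conjI allI impI exI[of _ "\<lambda>_. c"]) (auto simp: reflpD)
next
  case (insert b I)
  obtain d1 where "d1 > 0" and d1: "\<And>d. 0 < d \<Longrightarrow> d \<le> d1 \<Longrightarrow> \<exists>G. continuous_on (cball 0 d) G \<and>
      (\<forall>h\<in>cball 0 d. S c (G h) \<and> norm (G h - (c + (\<Sum>b\<in>I. (h \<bullet> b) *\<^sub>R Z b c))) \<le> e / 4 * d)"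
    using insert.IH[of "e / 4"] insert.prems by auto
  have "steers S c R 1 (\<lambda>h y. y + h *\<^sub>R Z b y)" "R / 2 < R" "e / 4 > 0"
    using insert.prems \<open>R > 0\<close> by auto
  from steersE[OF this] obtain d2 where "d2 > 0" and d2: "\<And>d. 0 < d \<Longrightarrow> d \<le> d2 \<Longrightarrow>
      \<exists>A. steering S (cball c (R / 2)) d (e / 4 * d^1) (\<lambda>h y. y + h *\<^sub>R Z b y) A" by blast
  have "continuous (at c) (Z b)" "e / 4 > 0" using insert.prems by auto
  then obtain \<delta> where "\<delta> > 0" and \<delta>: "\<And>z. dist z c < \<delta> \<Longrightarrow> dist (Z b z) (Z b c) < e / 4"
    unfolding continuous_at_eps_delta by blast
  \<comment> \<open>Bounds \<open>norm (G h - c) / d\<close>: the linear combination plus the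
    inductive error.\<close>
  define C where "C = (\<Sum>b\<in>I. norm (Z b c)) + e / 4"
  have "C > 0" using insert.prems(4) by (simp add: C_def add_nonneg_pos sum_nonneg)
  define d0 where "d0 = Min {d1, d2, \<delta> / 2 / C, R / 2 / C}"
  have "d0 > 0" using \<open>d1 > 0\<close> \<open>d2 > 0\<close> \<open>\<delta> > 0\<close> \<open>R > 0\<close> \<open>C > 0\<close> by (simp add: d0_def)
  have "\<exists>G. continuous_on (cball 0 d) G \<and>
      (\<forall>h\<in>cball 0 d. S c (G h) \<and> norm (G h - (c + (\<Sum>b\<in>insert b I. (h \<bullet> b) *\<^sub>R Z b c))) \<le> e * d)"
    if dd: "0 < d" "d \<le> d0" for d
  proof -
    have d: "d \<le> d1" "d \<le> d2" using dd(2) by (auto simp: d0_def)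
    have "d \<le> \<delta> / 2 / C" "d \<le> R / 2 / C" using dd(2) by (auto simp: d0_def)
    then have Cd: "d * C \<le> \<delta> / 2" "d * C \<le> R / 2" using \<open>C > 0\<close> by (simp_all only: pos_le_divide_eq)
    obtain G where G: "continuous_on (cball 0 d) G" "\<And>h. h \<in> cball 0 d \<Longrightarrow> S c (G h)"
      "\<And>h. h \<in> cball 0 d \<Longrightarrow> norm (G h - (c + (\<Sum>b\<in>I. (h \<bullet> b) *\<^sub>R Z b c))) \<le> e / 4 * d"
      using d1[OF dd(1) d(1)] by blast
    obtain A where A: "steering S (cball c (R / 2)) d (e / 4 * d) (\<lambda>h y. y + h *\<^sub>R Z b y) A"
      using d2[OF dd(1) d(2)] by auto
    have coord: "\<bar>h \<bullet> b'\<bar> \<le> d" if "h \<in> cball 0 d" "b' \<in> insert b I" for h b'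
      using that insert.prems(1) Basis_le_norm[of b' h] by auto
    have near: "norm (G h - c) \<le> d * C" if h: "h \<in> cball 0 d" for h
    proof -
      have "norm (\<Sum>b\<in>I. (h \<bullet> b) *\<^sub>R Z b c) \<le> (\<Sum>b\<in>I. d * norm (Z b c))"
        using coord[OF h] by (intro sum_norm_le) (auto intro!: mult_right_mono)
      then have "norm ((\<Sum>b\<in>I. (h \<bullet> b) *\<^sub>R Z b c) + (G h - (c + (\<Sum>b\<in>I. (h \<bullet> b) *\<^sub>R Z b c))))
          \<le> (\<Sum>b\<in>I. d * norm (Z b c)) + e / 4 * d"
        using G(3)[OF h] by (rule norm_triangle_mono)
      then show ?thesis by (simp add: C_def sum_distrib_left algebra_simps)
    qed
    have Gin: "G h \<in> cball c (R / 2)" if "h \<in> cball 0 d" for h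
      using near[OF that] Cd(2) by (simp add: dist_norm norm_minus_commute)
    have AG: "S (G h) (A (h \<bullet> b) (G h))"
      "norm (A (h \<bullet> b) (G h) - (G h + (h \<bullet> b) *\<^sub>R Z b (G h))) \<le> e / 4 * d" if "h \<in> cball 0 d" for h
      using A Gin[OF that] coord[OF that, of b] by (auto simp: steering_def abs_le_iff)
    have "norm (A (h \<bullet> b) (G h) - (c + (\<Sum>b\<in>insert b I. (h \<bullet> b) *\<^sub>R Z b c))) \<le> e * d"
      if h: "h \<in> cball 0 d" for h
    proof -
      have "dist (G h) c < \<delta>" using near[OF h] Cd(1) \<open>\<delta> > 0\<close> by (simp add: dist_norm)
      from \<delta>[OF this] have "norm ((h \<bullet> b) *\<^sub>R (Z b (G h) - Z b c)) \<le> d * (e / 4)"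
        unfolding norm_scaleR dist_norm using coord[OF h, of b] by (intro mult_mono) auto
      then have "norm ((A (h \<bullet> b) (G h) - (G h + (h \<bullet> b) *\<^sub>R Z b (G h)))
          + ((h \<bullet> b) *\<^sub>R (Z b (G h) - Z b c) + (G h - (c + (\<Sum>b\<in>I. (h \<bullet> b) *\<^sub>R Z b c)))))
          \<le> e / 4 * d + (d * (e / 4) + e / 4 * d)"
        using AG(2)[OF h] G(3)[OF h] by (intro norm_triangle_mono)
      also have "\<dots> \<le> e * d" using insert.prems(4) dd(1) by simp
      finally show ?thesis using insert.hyps by (simp add: algebra_simps)
    qed
    moreover have "S c (A (h \<bullet> b) (G h))" if "h \<in> cball 0 d" for h
      using transpD[OF S(2) G(2)[OF that] AG(1)[OF that]] .
    moreover have "continuous_on (cball 0 d) (\<lambda>h. A (h \<bullet> b) (G h))"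
      by (rule continuous_on_steering[OF A _ G(1) _ Gin]) (use coord in \<open>auto intro!: continuous_intros\<close>)
    ultimately show ?thesis by blast
  qed
  then show ?case using \<open>d0 > 0\<close> by blast
qed

text \<open>\<open>G\<close> is within \<open>e * d\<close> of an invertible affine map on the ball
  of radius \<open>d\<close>. Such a continuous map covers a ball of radius proportional to
  \<open>d\<close> around \<open>c\<close>; no derivative of \<open>G\<close> is involved.\<close>

lemma reachable_neighbourhood:
  fixes Z :: "'a::euclidean_space \<Rightarrow> 'a \<Rightarrow> 'a"
  assumes S: "reflp S" "transp S" and "R > 0"
    and Z: "\<And>b. b \<in> Basis \<Longrightarrow> steers S c R 1 (\<lambda>h y. y + h *\<^sub>R Z b y)"
    and cont: "\<And>b. b \<in> Basis \<Longrightarrow> continuous (at c) (Z b)"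
    and span: "span ((\<lambda>b. Z b c) ` Basis) = UNIV"
  shows "\<exists>\<epsilon>>0. \<forall>z\<in>ball c \<epsilon>. S c z"
proof -
  define L where "L h = (\<Sum>b\<in>Basis. (h \<bullet> b) *\<^sub>R Z b c)" for h
  have "linear L" unfolding L_def
    by (intro linear_compose_sum ballI linearI) (simp_all add: inner_add_left scaleR_add_left)
  moreover have "surj L"
  proof -
    have "L b = Z b c" if "b \<in> Basis" for b
      using that by (simp add: L_def inner_Basis if_distrib[of "\<lambda>x. x *\<^sub>R _"] sum.delta' cong: if_cong)
    then have "(\<lambda>b. Z b c) ` Basis \<subseteq> range L" by (metis image_subsetI rangeI)
    from span_minimal[OF this linear_subspace_image[OF \<open>linear L\<close> subspace_UNIV]] show ?thesis
      using span by auto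
  qed
  ultimately obtain g where g: "linear g" "\<And>x. g (L x) = x" "\<And>x. L (g x) = x"
    using linear_surjective_isomorphism by metis
  interpret g: linear g by fact
  obtain K where "K > 0" and K: "\<And>v. norm (g v) \<le> K * norm v"
    using linear_bounded_pos[OF g(1)] by (metis mult.commute)
  \<comment> \<open>With \<open>K\<close> bounding the inverse \<open>g\<close> of \<open>L\<close>,
    this makes \<open>K * (e * d + e * d) = d\<close>, so that \<open>f\<close> below maps the ball
    into itself.\<close>
  define e where "e = 1 / (2 * K)"
  have "e > 0" using \<open>K > 0\<close> by (simp add: e_def)
  obtain d where "d > 0" and "\<exists>G. continuous_on (cball 0 d) G \<and>
      (\<forall>h\<in>cball 0 d. S c (G h) \<and> norm (G h - (c + L h)) \<le> e * d)"
    using steers_simultaneously[of S R Basis c Z e, OF S \<open>R > 0\<close> finite_Basis order_refl Z cont \<open>e > 0\<close>]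
    unfolding L_def by (metis order_refl)
  then obtain G where G: "continuous_on (cball 0 d) G" "\<And>h. h \<in> cball 0 d \<Longrightarrow> S c (G h)"
    "\<And>h. h \<in> cball 0 d \<Longrightarrow> norm (G h - (c + L h)) \<le> e * d" by blast
  have "S c z" if z: "z \<in> ball c (e * d)" for z
  proof -
    \<comment> \<open>A Newton map with frozen derivative: its fixed points are the solutions of
      \<open>G h = z\<close>.\<close>
    define f where "f h = h - g (G h - z)" for h
    have "continuous_on (cball 0 d) f"
      unfolding f_def
      by (intro continuous_intros G(1) linear_continuous_on_compose[OF _ g(1)])
    moreover have "f h \<in> cball 0 d" if h: "h \<in> cball 0 d" for h
    proof -
      have "f h = g (L h - (G h - z))" by (simp add: f_def g.diff g(2))
      also have "L h - (G h - z) = (z - c) - (G h - (c + L h))" by simp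
      finally have "norm (f h) \<le> K * norm ((z - c) - (G h - (c + L h)))" using K by simp
      also have "norm ((z - c) - (G h - (c + L h))) \<le> e * d + e * d"
      proof (rule norm_triangle_le_diff)
        have "norm (z - c) \<le> e * d" using z by (simp add: dist_norm norm_minus_commute)
        then show "norm (z - c) + norm (G h - (c + L h)) \<le> e * d + e * d"
          using G(3)[OF h] by linarith
      qed
      also have "K * (e * d + e * d) = d" using \<open>K > 0\<close> by (simp add: e_def field_simps)
      finally show ?thesis using \<open>K > 0\<close> by simp
    qed
    ultimately obtain h where h: "h \<in> cball 0 d" "f h = h"
      using brouwer[of "cball 0 d" f] \<open>d > 0\<close> by auto
    then have "L (g (G h - z)) = 0" by (simp add: f_def linear_0[OF \<open>linear L\<close>])
    then have "G h = z" by (simp add: g(3))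
    then show ?thesis using G(2)[OF h(1)] by simp
  qed
  then show ?thesis using \<open>e > 0\<close> \<open>d > 0\<close> by (intro exI[of _ "e * d"]) auto
qed

section \<open>Orbits\<close>

lemma onorm_matrix_vector_mult_le:
  fixes A :: "real^'p^'p"
  shows "onorm ((*v) A) \<le> real CARD('p) * real CARD('p) * norm A"
proof (rule onorm_le_matrix_component)
  show "\<bar>A $ i $ j\<bar> \<le> norm A" for i j
    using component_le_norm_cart[of "A $ i" j] Finite_Cartesian_Product.norm_nth_le[of A i] by linarith
qed

text \<open>Compactness of the ball makes the continuity of the Jacobian uniform, and convexity
  turns this into Lipschitz and Taylor bounds through the mean value inequality.\<close>

lemma uniformly_C1_jacobian:
  fixes Z :: "real^'p \<Rightarrow> real^'p"
  assumes "open V" and Z: "\<And>j. C_on 1 V (\<lambda>x. Z x $ j)" and V: "cball c R \<subseteq> V"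
  shows "uniformly_C1 (cball c R) Z (\<lambda>x v. jacobian Z (at x) *v v)"
proof -
  let ?J = "\<lambda>x. jacobian Z (at x)"
  let ?p = "real CARD('p) * real CARD('p)"
  have deriv: "(Z has_derivative (*v) (?J x)) (at x within S)" if "x \<in> cball c R" for x S
  proof -
    have "Z differentiable (at x)" by (rule C_on_vec_imp_differentiable[OF assms(1) Z]) (use that V in blast)
    then show ?thesis by (simp add: jacobian_works has_derivative_at_withinI)
  qed
  have contJ: "continuous_on (cball c R) ?J"
    by (rule continuous_on_subset[OF continuous_on_jacobian[OF assms(1) Z] V])
  have contZ: "continuous_on (cball c R) Z"
    unfolding continuous_on_eq_continuous_within by (blast intro: has_derivative_continuous deriv)
  obtain K1 where K1: "\<And>x. x \<in> cball c R \<Longrightarrow> norm (Z x) \<le> K1"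
    using compact_imp_bounded[OF compact_continuous_image[OF contZ compact_cball]]
    unfolding bounded_iff by (metis imageI)
  obtain K2 where K2: "\<And>x. x \<in> cball c R \<Longrightarrow> norm (?J x) \<le> K2"
    using compact_imp_bounded[OF compact_continuous_image[OF contJ compact_cball]]
    unfolding bounded_iff by (metis imageI)
  define M where "M = max K1 (?p * K2)"
  have onorm_M: "onorm ((*v) (?J x)) \<le> M" if "x \<in> cball c R" for x
  proof -
    have "?p * norm (?J x) \<le> ?p * K2" using K2[OF that] by (intro mult_left_mono) auto
    then show ?thesis unfolding M_def
      by (intro max.coboundedI2 order_trans[OF onorm_matrix_vector_mult_le])
  qed
  show ?thesis
    unfolding uniformly_C1_def
  proof (intro conjI allI impI)
    have "norm (?J y *v v) \<le> M * norm v" if "y \<in> cball c R" for y v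
      by (rule order_trans[OF onorm[OF matrix_vector_mul_bounded_linear]
            mult_right_mono[OF onorm_M[OF that] norm_ge_zero]])
    moreover have "norm (Z z - Z y) \<le> M * norm (z - y)" if "y \<in> cball c R" "z \<in> cball c R" for y z
      by (rule differentiable_bound[OF convex_cball deriv onorm_M that(2,1)])
    ultimately show "\<exists>M. \<forall>y\<in>cball c R. norm (Z y) \<le> M \<and> linear ((*v) (?J y)) \<and>
        (\<forall>v. norm (?J y *v v) \<le> M * norm v) \<and> (\<forall>z\<in>cball c R. norm (Z z - Z y) \<le> M * norm (z - y))"
      using K1 by (intro exI[of _ M]) (auto simp: M_def le_max_iff_disj)
  next
    fix e :: real assume "e > 0"
    have "?p > 0" by simp
    have "uniformly_continuous_on (cball c R) ?J"
      by (rule compact_uniformly_continuous[OF contJ compact_cball])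
    then obtain d1 where "d1 > 0" and
      d1: "\<And>x y. x \<in> cball c R \<Longrightarrow> y \<in> cball c R \<Longrightarrow> dist x y < d1 \<Longrightarrow> dist (?J x) (?J y) < e / ?p"
      using divide_pos_pos[OF \<open>e > 0\<close> \<open>?p > 0\<close>] unfolding uniformly_continuous_on_def by metis
    have "continuous_on (cball c R) (\<lambda>x. ?J x *v Z x)"
      unfolding matrix_vector_mult_def
      by (intro continuous_intros continuous_on_vec_lambda contJ contZ continuous_on_component)
    then have "uniformly_continuous_on (cball c R) (\<lambda>x. ?J x *v Z x)"
      by (rule compact_uniformly_continuous[OF _ compact_cball])
    then obtain d2 where "d2 > 0" and
      d2: "\<And>x y. x \<in> cball c R \<Longrightarrow> y \<in> cball c R \<Longrightarrow> dist x y < d2 \<Longrightarrow> dist (?J x *v Z x) (?J y *v Z y) < e"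
      using \<open>e > 0\<close> unfolding uniformly_continuous_on_def by metis
    define d where "d = min d1 d2 / 2"
    have d: "d > 0" "d < d1" "d < d2" using \<open>d1 > 0\<close> \<open>d2 > 0\<close> by (auto simp: d_def min_def)
    show "\<exists>d>0. \<forall>y\<in>cball c R. \<forall>z\<in>cball c R. norm (z - y) \<le> d \<longrightarrow>
        norm (Z z - Z y - ?J y *v (z - y)) \<le> e * norm (z - y) \<and> norm (?J z *v Z z - ?J y *v Z y) \<le> e"
    proof (intro exI[of _ d] conjI ballI impI d(1))
      fix y z assume y: "y \<in> cball c R" and z: "z \<in> cball c R" and yz: "norm (z - y) \<le> d"
      then show "norm (?J z *v Z z - ?J y *v Z y) \<le> e"
        using d2[of z y] d(3) by (simp add: dist_norm)
      \<comment> \<open>The segment from \<open>y\<close> to \<open>z\<close> lies in the convex set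
        \<open>cball c R \<inter> cball y d\<close>, on which the Jacobian differs from its value at
        \<open>y\<close> by at most \<open>e\<close> in operator norm.\<close>
      have "norm (Z z - Z y - ?J y *v (z - y)) \<le> norm (z - y) * e"
      proof (rule differentiable_bound_linearization[where S = "cball c R \<inter> cball y d"
            and f' = "\<lambda>x. (*v) (?J x)"])
        fix t :: real assume t: "t \<in> {0..1}"
        have "y + t *\<^sub>R (z - y) = (1 - t) *\<^sub>R y + t *\<^sub>R z" by (simp add: algebra_simps)
        moreover have "(1 - t) *\<^sub>R y + t *\<^sub>R z \<in> cball c R \<inter> cball y d"
          using t y z yz d(1) by (intro convexD convex_Int convex_cball) (auto simp: dist_norm norm_minus_commute)
        ultimately show "y + t *\<^sub>R (z - y) \<in> cball c R \<inter> cball y d" by simp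
      next
        fix x assume x: "x \<in> cball c R \<inter> cball y d"
        then show "(Z has_derivative (*v) (?J x)) (at x within cball c R \<inter> cball y d)"
          by (intro deriv) auto
        have "norm (?J x - ?J y) \<le> e / ?p"
          using d1[of x y] x y d(2) by (simp add: dist_norm norm_minus_commute less_imp_le)
        then have "?p * norm (?J x - ?J y) \<le> e"
          using \<open>?p > 0\<close> by (simp add: pos_le_divide_eq mult.commute)
        moreover have "(*v) (?J x) - (*v) (?J y) = (*v) (?J x - ?J y)"
          by (simp add: fun_eq_iff matrix_vector_mult_diff_rdistrib)
        ultimately show "onorm ((*v) (?J x) - (*v) (?J y)) \<le> e"
          using onorm_matrix_vector_mult_le[of "?J x - ?J y"] by simp
      qed (use y d(1) in auto)
      then show "norm (Z z - Z y - ?J y *v (z - y)) \<le> e * norm (z - y)" by (simp add: mult.commute)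
    qed
  qed
qed

lemma arc_reachable_neighbourhood:
  fixes X :: "nat \<Rightarrow> real^'p \<Rightarrow> real^'p"
  assumes "open V" "c \<in> V" "r \<ge> 2"
    and X: "\<And>i j. i \<in> {1..n} \<Longrightarrow> C_on (r - 1) V (\<lambda>x. X i x $ j)"
    and X0: "\<And>j. C_on (r - 2) V (\<lambda>x. X 0 x $ j)"
    and X0': "\<And>j. C_on 1 V (\<lambda>x. X 0 x $ j)"
    and span: "span {iterated_commutator X I c | I. I \<in> multiindices n \<and> weight I \<le> r} = UNIV"
  shows "\<exists>\<epsilon>>0. \<forall>z\<in>ball c \<epsilon>. (arc_step n X V)\<^sup>*\<^sup>* c z"
proof -
  let ?S = "(arc_step n X V)\<^sup>*\<^sup>*"
  have S: "reflp ?S" "transp ?S" by (auto intro: reflpI transpI)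
  obtain R where "R > 0" and R: "cball c R \<subseteq> V"
    using assms(1,2) open_contains_cball by blast
  have C_on_comm: "C_on (r - weight I) V (\<lambda>x. iterated_commutator X I x $ j)"
    if "I \<in> multiindices n" "weight I \<le> r" for I j
    by (rule C_on_iterated_commutator[of V n r X I j, OF assms(1) X X0 that])
  have XC1: "C_on 1 V (\<lambda>x. X i x $ j)" if "i \<in> {0..n}" for i j
  proof (cases "i = 0")
    case False
    then show ?thesis using that \<open>r \<ge> 2\<close> by (intro C_on_mono[OF X]) auto
  qed (use X0' in simp)
  have XU: "uniformly_C1 (cball c R) (X i) (\<lambda>x v. jacobian (X i) (at x) *v v)" if "i \<in> {0..n}" for i
    by (rule uniformly_C1_jacobian[OF assms(1) XC1[OF that] R])
  have X_steers: "steers ?S c R 1 (\<lambda>h y. y + h *\<^sub>R X i y)" if i: "i \<in> {0..n}" for i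
  proof (rule steers_flow[OF XU[OF i] \<open>R > 0\<close>])
    fix G \<phi> and T :: real
    assume "G = X i \<or> G = (\<lambda>y. - X i y)" "0 \<le> T" "\<phi> ` {0..T} \<subseteq> cball c R"
      and "\<And>t. t \<in> {0..T} \<Longrightarrow> (\<phi> has_vector_derivative G (\<phi> t)) (at t within {0..T})"
    then have "integral_curve (X i) (\<phi> 0) T \<phi> \<or> integral_curve (\<lambda>x. - X i x) (\<phi> 0) T \<phi>"
      "\<phi> ` {0..T} \<subseteq> V"
      using R unfolding integral_curve_def by blast+
    then have "arc_step n X V (\<phi> 0) (\<phi> T)"
      using i unfolding arc_step_def integral_arc_def by blast
    then show "?S (\<phi> 0) (\<phi> T)" by blast
  qed
  have steers: "steers ?S c R 1 (\<lambda>h y. y + h *\<^sub>R iterated_commutator X I y)"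
    if "I \<in> multiindices n" "weight I \<le> r" for I
    using that
  proof (induction I rule: induct_list012)
    case (2 i)
    then show ?case using X_steers by (simp add: multiindices_def)
  next
    case (3 i k J)
    have i: "i \<in> {0..n}" and kJ: "k # J \<in> multiindices n"
      using "3.prems" by (auto simp: multiindices_def)
    \<comment> \<open>Strict, since the removed entry weighs at least \<open>1\<close>. Thus the
      inner commutator has regularity \<open>r - weight (k # J) \<ge> 1\<close>, as bracketing
      requires.\<close>
    have w: "weight (k # J) < r" using "3.prems" by (auto simp: weight_Cons split: if_splits)
    define Y where "Y = iterated_commutator X (k # J)"
    have YC1: "C_on 1 V (\<lambda>x. Y x $ j)" for j
      unfolding Y_def using w by (intro C_on_mono[OF C_on_comm[OF kJ]]) auto
    have "steers ?S c R 1 (\<lambda>h y. y + h *\<^sub>R Y y)"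
      using "3.IH"(2)[OF kJ] w by (simp add: Y_def)
    from steers_commutator[OF S XU[OF i] uniformly_C1_jacobian[OF assms(1) YC1 R] X_steers[OF i] this]
    show ?case
    proof (rule steers_cong)
      fix h y assume "y \<in> cball c R"
      then have "y \<in> V" using R by auto
      then show "y + h *\<^sub>R (jacobian Y (at y) *v X i y - jacobian (X i) (at y) *v Y y)
          = y + h *\<^sub>R iterated_commutator X (i # k # J) y"
        using commutator_eq_jacobian[OF assms(1) XC1[OF i] YC1] by (simp add: Y_def)
    qed
  qed (simp add: multiindices_def)
  define \<I> where "\<I> = {I. I \<in> multiindices n \<and> weight I \<le> r}"
  let ?T = "(\<lambda>I. iterated_commutator X I c) ` \<I>"
  have T: "span ?T = UNIV"
    using span by (simp add: \<I>_def image_Collect)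
  \<comment> \<open>From the spanning commutators a basis is extracted and reindexed by the standard
    basis, so that steering parameters become coordinates.\<close>
  obtain B where B: "B \<subseteq> ?T" "independent B" "?T \<subseteq> span B"
    by (rule maximal_independent_subset)
  then have spanB: "span B = UNIV" using T span_mono span_span by (metis top.extremum_uniqueI)
  then have "card B = card (Basis :: (real^'p) set)"
    using B(2) by (metis dim_UNIV dim_span_eq_card_independent dim_eq_card_independent dim_span)
  then obtain \<beta> where \<beta>: "bij_betw \<beta> (Basis :: (real^'p) set) B"
    using finite_same_card_bij[OF finite_Basis independent_imp_finite[OF B(2)]] by metis
  have "\<forall>b\<in>Basis. \<exists>I\<in>\<I>. iterated_commutator X I c = \<beta> b"
    using B(1) \<beta> by (force simp: bij_betw_def)
  then obtain J where J: "\<And>b. b \<in> Basis \<Longrightarrow> J b \<in> \<I>" "\<And>b. b \<in> Basis \<Longrightarrow> iterated_commutator X (J b) c = \<beta> b"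
    by metis
  show ?thesis
  proof (rule reachable_neighbourhood[OF S \<open>R > 0\<close>, where Z = "\<lambda>b. iterated_commutator X (J b)"])
    fix b :: "real^'p" assume "b \<in> Basis"
    then have Jb: "J b \<in> multiindices n" "weight (J b) \<le> r" using J(1) by (auto simp: \<I>_def)
    show "steers ?S c R 1 (\<lambda>h y. y + h *\<^sub>R iterated_commutator X (J b) y)" by (rule steers[OF Jb])
    have "C_on 0 V (\<lambda>x. iterated_commutator X (J b) x $ j)" for j
      using C_on_mono[OF C_on_comm[OF Jb]] by simp
    then have "continuous_on V (\<lambda>x. \<chi> j. iterated_commutator X (J b) x $ j)"
      by (intro continuous_on_vec_lambda) (simp add: C_on_0)
    then show "continuous (at c) (iterated_commutator X (J b))"
      using assms(1,2) by (simp add: continuous_on_eq_continuous_at)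
  next
    have "(\<lambda>b. iterated_commutator X (J b) c) ` Basis = B"
      using J(2) \<beta> by (simp add: bij_betw_def cong: image_cong_simp)
    then show "span ((\<lambda>b. iterated_commutator X (J b) c) ` Basis) = UNIV" using spanB by simp
  qed
qed

lemma arc_connected:
  assumes "connected V"
    and nbhd: "\<And>c. c \<in> V \<Longrightarrow> \<exists>\<epsilon>>0. \<forall>z\<in>ball c \<epsilon>. (arc_step n X V)\<^sup>*\<^sup>* c z"
    and "x \<in> V" "y \<in> V"
  shows "connected_by_integral_arcs n X V x y"
proof -
  let ?S = "(arc_step n X V)\<^sup>*\<^sup>*"
  have sym: "?S z w \<Longrightarrow> ?S w z" for z w
    using symp_rtranclp[OF symp_arc_step] by (rule sympD)
  have stay: "z \<in> V" if "?S x z" for z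
    using that \<open>x \<in> V\<close> by (induction rule: rtranclp_induct) (auto dest: arc_step_imp_in_domain)
  define A where "A = {z. ?S x z}"
  have "open A"
    unfolding open_contains_ball
  proof
    fix z assume "z \<in> A"
    then have "?S x z" "z \<in> V" using stay by (auto simp: A_def)
    with nbhd[of z] show "\<exists>e>0. ball z e \<subseteq> A"
      unfolding A_def by (auto dest: rtranclp_trans)
  qed
  \<comment> \<open>Symmetry of reachability is needed here: if a point reached from
    \<open>z\<close> were in the orbit of \<open>x\<close>, then going back would put
    \<open>z\<close> there too.\<close>
  moreover have "open (V - A)"
    unfolding open_contains_ball
  proof
    fix z assume "z \<in> V - A"
    then obtain e where "e > 0" and e: "\<And>w. w \<in> ball z e \<Longrightarrow> ?S z w" and "\<not> ?S x z" using nbhd[of z] by (auto simp: A_def)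
    have "w \<in> V - A" if "w \<in> ball z e" for w
    proof -
      have "w \<in> V"
        using e[OF that] \<open>z \<in> V - A\<close>
        by (induction rule: rtranclp_induct) (auto dest: arc_step_imp_in_domain)
      moreover have "\<not> ?S x w" using sym[OF e[OF that]] \<open>\<not> ?S x z\<close> by (auto dest: rtranclp_trans)
      ultimately show ?thesis by (simp add: A_def)
    qed
    then show "\<exists>e>0. ball z e \<subseteq> V - A" using \<open>e > 0\<close> by blast
  qed
  ultimately have "A \<inter> V = {} \<or> (V - A) \<inter> V = {}"
    by (intro connectedD[OF \<open>connected V\<close>]) auto
  moreover have "x \<in> A" by (simp add: A_def)
  ultimately have "y \<in> A" using \<open>x \<in> V\<close> \<open>y \<in> V\<close> by blast
  then show ?thesis
    unfolding A_def using connected_by_integral_arcs_if_rtranclp \<open>x \<in> V\<close> by blast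
qed

theorem theorem5p5:
  fixes X :: "nat \<Rightarrow> real^'p \<Rightarrow> real^'p" and \<Omega> :: "(real^'p) set" and n r :: nat
  assumes "open \<Omega>" and "bounded \<Omega>"
    and "r \<ge> 2"
    and "assumptions_C r n \<Omega> X"
  shows "(\<forall>x\<^sub>0\<in>\<Omega>. \<exists>U V. open U \<and> open V \<and> x\<^sub>0 \<in> U \<and> U \<subseteq> V \<and> V \<subseteq> \<Omega> \<and>
            (\<forall>x\<in>U. \<forall>y\<in>U. connected_by_integral_arcs n X V x y)) \<and>
         (connected \<Omega> \<longrightarrow> (\<forall>x\<in>\<Omega>. \<forall>y\<in>\<Omega>. connected_by_integral_arcs n X \<Omega> x y))"
proof -
  have X: "C_on (r - 1) \<Omega> (\<lambda>x. X i x $ j)" if "i \<in> {1..n}" for i j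
    using assms(4) that by (auto simp: assumptions_C_def C_on_closure_def)
  have X0: "C_on (r - 2) \<Omega> (\<lambda>x. X 0 x $ j)" for j
    using assms(4) by (auto simp: assumptions_C_def C_on_closure_def)
  \<comment> \<open>The case \<open>r = 2\<close> is the separate assumption on \<open>X 0\<close>;
    otherwise \<open>r - 2 \<ge> 1\<close>.\<close>
  have X0': "C_on 1 \<Omega> (\<lambda>x. X 0 x $ j)" for j
  proof (cases "r = 2")
    case True
    then show ?thesis using assms(4) by (auto simp: assumptions_C_def)
  next
    case False
    then show ?thesis using \<open>r \<ge> 2\<close> by (intro C_on_mono[OF X0]) auto
  qed
  have span: "span {iterated_commutator X I x | I. I \<in> multiindices n \<and> weight I \<le> r} = UNIV" if "x \<in> \<Omega>" for x
    using assms(4) that by (auto simp: assumptions_C_def)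
  \<comment> \<open>Stated for every open connected \<open>V \<subseteq> \<Omega>\<close>, because
    the hypotheses restrict to \<open>V\<close> and the arcs are then confined to it. A ball gives
    the local claim, \<open>\<Omega>\<close> itself the global one.\<close>
  have conn: "connected_by_integral_arcs n X V x y"
    if "open V" "connected V" "V \<subseteq> \<Omega>" "x \<in> V" "y \<in> V" for V x y
  proof (rule arc_connected[OF \<open>connected V\<close> _ \<open>x \<in> V\<close> \<open>y \<in> V\<close>])
    fix c assume "c \<in> V"
    show "\<exists>\<epsilon>>0. \<forall>z\<in>ball c \<epsilon>. (arc_step n X V)\<^sup>*\<^sup>* c z"
    proof (rule arc_reachable_neighbourhood[OF \<open>open V\<close> \<open>c \<in> V\<close> \<open>r \<ge> 2\<close>])
      show "C_on (r - 1) V (\<lambda>x. X i x $ j)" if "i \<in> {1..n}" for i j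
        by (rule C_on_subset[OF X[OF that] \<open>V \<subseteq> \<Omega>\<close>])
      show "C_on (r - 2) V (\<lambda>x. X 0 x $ j)" "C_on 1 V (\<lambda>x. X 0 x $ j)" for j
        by (rule C_on_subset[OF X0 \<open>V \<subseteq> \<Omega>\<close>], rule C_on_subset[OF X0' \<open>V \<subseteq> \<Omega>\<close>])
      show "span {iterated_commutator X I c | I. I \<in> multiindices n \<and> weight I \<le> r} = UNIV"
        by (rule span) (use \<open>c \<in> V\<close> \<open>V \<subseteq> \<Omega>\<close> in blast)
    qed
  qed
  have "\<exists>U V. open U \<and> open V \<and> x\<^sub>0 \<in> U \<and> U \<subseteq> V \<and> V \<subseteq> \<Omega> \<and>
            (\<forall>x\<in>U. \<forall>y\<in>U. connected_by_integral_arcs n X V x y)" if x\<^sub>0: "x\<^sub>0 \<in> \<Omega>" for x\<^sub>0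
  proof -
    obtain \<epsilon> where "\<epsilon> > 0" "ball x\<^sub>0 \<epsilon> \<subseteq> \<Omega>"
      using \<open>open \<Omega>\<close> x\<^sub>0 unfolding open_contains_ball by blast
    show ?thesis
    proof (intro exI conjI ballI)
      fix x y assume "x \<in> ball x\<^sub>0 \<epsilon>" "y \<in> ball x\<^sub>0 \<epsilon>"
      then show "connected_by_integral_arcs n X (ball x\<^sub>0 \<epsilon>) x y"
        by (rule conn[OF open_ball connected_ball \<open>ball x\<^sub>0 \<epsilon> \<subseteq> \<Omega>\<close>])
    qed (use \<open>\<epsilon> > 0\<close> \<open>ball x\<^sub>0 \<epsilon> \<subseteq> \<Omega>\<close> in auto)
  qed
  then show ?thesis using conn[OF \<open>open \<Omega>\<close>] by blast
qed

end
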